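(* Given an $n$-vertex digraph $D$ whose underlying undirected graph is a fuzzy circular interval graph, with arbitrary edge orientations, one can compute the number of kernels of $D$ and, if $D$ has a kernel, return one, in time polynomial in $n$.
   Context: A digraph is a simple, loopless, finite graph with each edge oriented in one or both directions; two vertices are adjacent if joined by an edge in either direction. A kernel is an independent set $k$ of vertices such that every vertex not in $k$ has an out-neighbour in $k$. For points $a,b$ of the unit circle $\mathbf S^1$, $[a;b]$ is the closed arc from $a$ to $b$ going anticlockwise, with $[a;a]=\{a\}$. A graph $G$ is a fuzzy circular interval graph if there exist $f\colon V(G)\to\mathbf S^1$ and a set $\mathcal I$ of arcs $[a;b]$ with $a\neq b$ such that: (1) no two arcs of $\mathcal I$ share an endpoint; (2) no proper inclusions among members of $\mathcal I$; (3) for every two adjacent vertices $x,y$ there is $I\in\mathcal I$ with $f(x),f(y)\in I$; (4) for every two non-adjacent vertices $x,y$ and every $I\in\mathcal I$, if $f(x),f(y)\in I$ then the endpoints of $I$ are $f(x)$ and $f(y)$. *)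

theory Defs
  imports
    "HOL-Analysis.Analysis"
    "HOL-Computational_Algebra.Polynomial"
    "Graph_Theory.Graph_Theory"
begin

section \<open>Kernels\<close>

definition is_kernel :: "'a pair_pre_digraph \<Rightarrow> 'a set \<Rightarrow> bool" where
  "is_kernel D K \<longleftrightarrow>
     K \<subseteq> pverts D \<and>
     (\<forall>u\<in>K. \<forall>v\<in>K. \<not> u \<rightarrow>\<^bsub>D\<^esub> v) \<and>
     (\<forall>u\<in>pverts D - K. \<exists>v\<in>K. u \<rightarrow>\<^bsub>D\<^esub> v)"

section \<open>Fuzzy circular interval graphs\<close>

text \<open>Since \<^const>\<open>Arg2pi\<close> has values in \<open>[0, 2\<pi>)\<close> and \<open>Arg2pi 1 = 0\<close>, for \<open>a\<close> and \<open>b\<close> on the unit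
  circle this is the anticlockwise closed arc \<open>[a;b]\<close>, with \<open>[a;a] = {a}\<close>.\<close>

definition circle_arc :: "complex \<Rightarrow> complex \<Rightarrow> complex set" where
  "circle_arc a b = {a * cis t |t. 0 \<le> t \<and> t \<le> Arg2pi (b / a)}"

text \<open>An undirected graph is a symmetric digraph. A family of arcs is given by the pairs of
  endpoints \<open>(a, b)\<close> of its members \<open>[a;b]\<close>; as \<open>a \<noteq> b\<close>, arc and pair determine each other.\<close>

definition fuzzy_circular_interval_graph :: "'a pair_pre_digraph \<Rightarrow> bool" where
  "fuzzy_circular_interval_graph G \<longleftrightarrow>
     (\<exists>(f :: 'a \<Rightarrow> complex) (\<I> :: (complex \<times> complex) set).
        f ` pverts G \<subseteq> sphere 0 1 \<and>
        (\<forall>(a, b)\<in>\<I>. a \<in> sphere 0 1 \<and> b \<in> sphere 0 1 \<and> a \<noteq> b) \<and>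
        (\<forall>(a, b)\<in>\<I>. \<forall>(c, d)\<in>\<I>. (a, b) \<noteq> (c, d) \<longrightarrow> {a, b} \<inter> {c, d} = {}) \<and>
        (\<forall>(a, b)\<in>\<I>. \<forall>(c, d)\<in>\<I>. \<not> circle_arc a b \<subset> circle_arc c d) \<and>
        (\<forall>x\<in>pverts G. \<forall>y\<in>pverts G. x \<rightarrow>\<^bsub>G\<^esub> y \<longrightarrow>
           (\<exists>(a, b)\<in>\<I>. f x \<in> circle_arc a b \<and> f y \<in> circle_arc a b)) \<and>
        (\<forall>x\<in>pverts G. \<forall>y\<in>pverts G. x \<noteq> y \<and> \<not> x \<rightarrow>\<^bsub>G\<^esub> y \<longrightarrow>
           (\<forall>(a, b)\<in>\<I>. f x \<in> circle_arc a b \<and> f y \<in> circle_arc a b \<longrightarrow> {a, b} = {f x, f y})))"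

section \<open>Model of computation\<close>

text \<open>
  Jones's WHILE language over binary trees (N. D. Jones, Computability and Complexity from a
  Programming Perspective, 1997). There is no arithmetic: numbers have to be represented by trees.
  Every access to a variable is charged the size of the tree stored in it, so the cost of an
  expression is an upper bound for the size of its value, and a multitape Turing machine simulates
  \<open>t\<close> units of cost, on an input of size \<open>m\<close>, in time polynomial in \<open>t + m\<close>. Conversely a Turing
  machine step takes time polynomial in the size of the tapes. Hence polynomial time in this model
  is polynomial time on Turing machines.
\<close>

datatype btree = Lf | Nd btree btree

fun left :: "btree \<Rightarrow> btree" where
  "left Lf = Lf"
| "left (Nd a b) = a"

fun right :: "btree \<Rightarrow> btree" where
  "right Lf = Lf"
| "right (Nd a b) = b"

datatype exp = Var nat | LF | ND exp exp | LEFT exp | RIGHT exp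

type_synonym state = "nat \<Rightarrow> btree"

fun val :: "exp \<Rightarrow> state \<Rightarrow> btree" where
  "val (Var x) s = s x"
| "val LF s = Lf"
| "val (ND e e') s = Nd (val e s) (val e' s)"
| "val (LEFT e) s = left (val e s)"
| "val (RIGHT e) s = right (val e s)"

text \<open>\<^term>\<open>size t\<close> is the number of inner nodes of \<^term>\<open>t\<close>.\<close>

fun cost :: "exp \<Rightarrow> state \<Rightarrow> nat" where
  "cost (Var x) s = Suc (size (s x))"
| "cost LF s = 1"
| "cost (ND e e') s = Suc (cost e s + cost e' s)"
| "cost (LEFT e) s = Suc (cost e s)"
| "cost (RIGHT e) s = Suc (cost e s)"

lemma size_val_le_cost: "size (val e s) \<le> cost e s"
proof (induction e)
  case (LEFT e)
  then show ?case by (cases "val e s") auto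
next
  case (RIGHT e)
  then show ?case by (cases "val e s") auto
qed auto

datatype com = Skip | Assign nat exp | Seq com com | Cond exp com com | While exp com

text \<open>\<open>exec c s t s'\<close>: started in state \<open>s\<close>, the program \<open>c\<close> halts in state \<open>s'\<close> at cost \<open>t\<close>.
  The tree \<^const>\<open>Lf\<close> counts as false, any other tree as true.\<close>

inductive exec :: "com \<Rightarrow> state \<Rightarrow> nat \<Rightarrow> state \<Rightarrow> bool" where
  Skip: "exec Skip s 1 s"
| Assign: "exec (Assign x e) s (Suc (cost e s)) (s(x := val e s))"
| Seq: "exec c1 s t1 s1 \<Longrightarrow> exec c2 s1 t2 s2 \<Longrightarrow> exec (Seq c1 c2) s (t1 + t2) s2"
| CondTrue: "val e s \<noteq> Lf \<Longrightarrow> exec c1 s t s' \<Longrightarrow> exec (Cond e c1 c2) s (Suc (cost e s + t)) s'"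
| CondFalse: "val e s = Lf \<Longrightarrow> exec c2 s t s' \<Longrightarrow> exec (Cond e c1 c2) s (Suc (cost e s + t)) s'"
| WhileFalse: "val e s = Lf \<Longrightarrow> exec (While e c) s (Suc (cost e s)) s"
| WhileTrue: "val e s \<noteq> Lf \<Longrightarrow> exec c s t1 s1 \<Longrightarrow> exec (While e c) s1 t2 s2 \<Longrightarrow>
    exec (While e c) s (Suc (cost e s + t1 + t2)) s2"

inductive_cases SkipE: "exec Skip s t s'"
  and AssignE: "exec (Assign x e) s t s'"
  and SeqE: "exec (Seq c1 c2) s t s'"
  and CondE: "exec (Cond e c1 c2) s t s'"
  and WhileE: "exec (While e c) s t s'"

lemma exec_deterministic:
  "exec c s t s' \<Longrightarrow> exec c s u s'' \<Longrightarrow> t = u \<and> s' = s''"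
proof (induction arbitrary: u s'' rule: exec.induct)
  case (Skip s)
  then show ?case by (auto elim: SkipE)
next
  case (Assign x e s)
  then show ?case by (auto elim: AssignE)
next
  case (Seq c1 s t1 s1 c2 t2 s2)
  from Seq.prems obtain u1 r1 u2 where
    "exec c1 s u1 r1" "exec c2 r1 u2 s''" "u = u1 + u2"
    by (rule SeqE)
  with Seq.IH show ?case by metis
next
  case (CondTrue e s c1 t s' c2)
  from CondTrue.prems CondTrue.hyps obtain u1 where
    "exec c1 s u1 s''" "u = Suc (cost e s + u1)"
    by (auto elim: CondE)
  with CondTrue.IH show ?case by metis
next
  case (CondFalse e s c2 t s' c1)
  from CondFalse.prems CondFalse.hyps obtain u1 where
    "exec c2 s u1 s''" "u = Suc (cost e s + u1)"
    by (auto elim: CondE)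
  with CondFalse.IH show ?case by metis
next
  case (WhileFalse e s c)
  from WhileFalse.prems show ?case
    by (rule WhileE) (simp_all add: WhileFalse.hyps)
next
  case (WhileTrue e s c t1 s1 t2 s2)
  from WhileTrue.prems obtain u1 r1 u2 where
    "exec c s u1 r1" "exec (While e c) r1 u2 s''" "u = Suc (cost e s + u1 + u2)"
    by (rule WhileE) (simp_all add: WhileTrue.hyps)
  with WhileTrue.IH show ?case by metis
qed

text \<open>\<open>computes_in c i t out\<close>: on input \<open>i\<close>, the program \<open>c\<close> halts with output \<open>out\<close> at cost \<open>t\<close>;
  input and output are in variable 0.\<close>

definition computes_in :: "com \<Rightarrow> btree \<Rightarrow> nat \<Rightarrow> btree \<Rightarrow> bool" where
  "computes_in c i t out \<longleftrightarrow> (\<exists>s. exec c ((\<lambda>_. Lf)(0 := i)) t s \<and> s 0 = out)"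

section \<open>Encoding of inputs and outputs\<close>

fun enc_list :: "btree list \<Rightarrow> btree" where
  "enc_list [] = Lf"
| "enc_list (x # xs) = Nd x (enc_list xs)"

definition enc_bool :: "bool \<Rightarrow> btree" where
  "enc_bool b = (if b then Nd Lf Lf else Lf)"

definition enc_bits :: "bool list \<Rightarrow> btree" where
  "enc_bits bs = enc_list (map enc_bool bs)"

text \<open>The adjacency matrix of a digraph with vertices \<open>0, \<dots>, n - 1\<close>.\<close>

definition enc_digraph :: "nat \<Rightarrow> nat pair_pre_digraph \<Rightarrow> btree" where
  "enc_digraph n D = enc_list (map (\<lambda>u. enc_bits (map (\<lambda>v. u \<rightarrow>\<^bsub>D\<^esub> v) [0..<n])) [0..<n])"

text \<open>The characteristic vector of a subset of \<open>{0, \<dots>, n - 1}\<close>.\<close>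

definition enc_set :: "nat \<Rightarrow> nat set \<Rightarrow> btree" where
  "enc_set n K = enc_bits (map (\<lambda>v. v \<in> K) [0..<n])"

text \<open>Binary notation, least significant bit first, possibly padded with zeros.\<close>

definition binary_of :: "bool list \<Rightarrow> nat \<Rightarrow> bool" where
  "binary_of bs m \<longleftrightarrow> horner_sum of_bool 2 bs = m"

end

theory Submission
  imports Defs
begin

text \<open>
  No representation of the graph by arcs is computed. Cut the vertices into breadth-first layers,
  with a new root whenever no unvisited vertex has a neighbour in the last layer; adjacent vertices
  then lie in the same or in consecutive layers. In a fuzzy circular interval graph an independent
  subset of a layer has at most four elements: among five of them, ordered by their angle from the
  root, a path of the search tree to the middle one crosses strictly inside some arc over one of
  the others, which is therefore adjacent to both ends of an edge of that path, against the choice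
  of the layers.

  A set \<open>K\<close> of vertices is a kernel iff for every vertex \<open>v\<close>, exactly one of the following holds:
  \<open>v \<in> K\<close>, or \<open>v\<close> has an out-neighbour in \<open>K\<close>. For a vertex \<open>v\<close> of a layer this only depends on the traces of \<open>K\<close> on
  that layer and its two neighbours, each of which is one of polynomially many sets. So kernels can
  be counted layer by layer, remembering only the last two traces.
\<close>

section \<open>Polynomial-time computable functions\<close>


text \<open>The bound is four because the contradiction takes 2 + 1 + 2 elements. The parent of the
  middle element may sit at the same point of the circle as an element on one side, and crossing
  needs a point different from it; hence two candidates on each side. Angles are measured from the
  root, so the root lies outside every open range of angles between two elements, while the middle
  element lies inside one: the path has to change sides. Passing strictly inside an arc matters
  because condition (4) exempts pairs at the endpoints of an arc. A vertex strictly inside an arc is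
  adjacent to all other vertices of that arc. Only the edges before the last contradict the layers:
  they would join the layer to one at least two steps away. A crossing by the last edge makes two
  elements of the independent set adjacent. The number of kernels can be exponential, for instance
  in a disjoint union of digons. So counts are kept in binary, and each table entry carries one
  witness instead of a list of partial kernels.\<close>

lemma poly_nat_mono: "m \<le> n \<Longrightarrow> poly (p :: nat poly) m \<le> poly p n"
  by (induction p) (auto intro!: add_mono mult_mono)

section \<open>Encoding of data as trees\<close>

class encodable =
  fixes encode :: "'a \<Rightarrow> btree"

instantiation bool :: encodable
begin
definition "encode = enc_bool"
instance ..
end

instantiation prod :: (encodable, encodable) encodable
begin
definition "encode p = Nd (encode (fst p)) (encode (snd p))"
instance ..
end

instantiation list :: (encodable) encodable
begin
definition "encode xs = enc_list (map encode xs)"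
instance ..
end

text \<open>Unary is affordable because numbers only serve as vertices, lengths and widths; the
  possibly exponential number of kernels is a list of bits instead.\<close>

instantiation nat :: encodable
begin
definition "encode n = enc_list (replicate n Lf)"
instance ..
end

abbreviation esize :: "'a::encodable \<Rightarrow> nat" where
  "esize x \<equiv> size (encode x)"

lemma encode_simps [simp]:
  "encode (x, y) = Nd (encode x) (encode y)"
  "encode True = Nd Lf Lf" "encode False = Lf"
  "encode ([] :: 'a::encodable list) = Lf"
  "encode (a # as) = Nd (encode (a::'a::encodable)) (encode as)"
  "encode (0::nat) = Lf" "encode (Suc n) = Nd Lf (encode n)"
  by (simp_all add: encode_prod_def encode_bool_def enc_bool_def encode_list_def encode_nat_def)

lemma encode_eq_Lf_iff [simp]:
  "encode b = Lf \<longleftrightarrow> \<not> b" "encode xs = Lf \<longleftrightarrow> xs = []" "encode n = Lf \<longleftrightarrow> n = (0::nat)"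
  by (cases b, auto) (cases xs, auto, cases n, auto)

lemma left_encode [simp]: "left (encode p) = encode (fst p)"
  and right_encode [simp]: "right (encode p) = encode (snd p)"
  by (simp_all add: encode_prod_def)

lemma esize_prod: "esize p = Suc (esize (fst p) + esize (snd p))"
  by (simp add: encode_prod_def)

lemma esize_nat [simp]: "esize (n::nat) = n"
  by (induction n) auto

lemma esize_bool_le: "esize (b::bool) \<le> 1"
  by (cases b) auto

lemma length_le_esize: "length xs \<le> esize xs"
  by (induction xs) auto

section \<open>Programs with polynomial cost and their combination\<close>

lemma exec_AssignI: "s' = s(x := val e s) \<Longrightarrow> t = Suc (cost e s) \<Longrightarrow> exec (Assign x e) s t s'"
  by (simp add: exec.Assign)

lemma exec_size: "exec c s t s' \<Longrightarrow> size (s' x) \<le> size (s x) + t"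
proof (induction rule: exec.induct)
  case (Assign y e s)
  then show ?case using size_val_le_cost[of e s] by auto
qed auto

text \<open>Nothing is assumed of the variables other than 0, so a program may be started on
  whatever another one has left behind. The bound \<open>N\<close> separates the variables it may
  overwrite from those it preserves.\<close>

definition runs :: "com \<Rightarrow> nat \<Rightarrow> nat poly \<Rightarrow> ('a::encodable \<Rightarrow> 'b::encodable) \<Rightarrow> bool" where
  "runs c N p f \<longleftrightarrow> (\<forall>s x. s 0 = encode x \<longrightarrow>
     (\<exists>t s'. exec c s t s' \<and> s' 0 = encode (f x) \<and> (\<forall>y\<ge>N. s' y = s y) \<and> t \<le> poly p (esize x)))"

definition ptime :: "('a::encodable \<Rightarrow> 'b::encodable) \<Rightarrow> bool" where
  "ptime f \<longleftrightarrow> (\<exists>c N p. runs c N p f)"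

lemma runsE:
  assumes "runs c N p f" "s 0 = encode x"
  obtains t s' where "exec c s t s'" "s' 0 = encode (f x)" "\<And>y. y \<ge> N \<Longrightarrow> s' y = s y"
    "t \<le> poly p (esize x)"
  using assms unfolding runs_def by blast

lemma runsI:
  assumes "\<And>s x. s 0 = encode x \<Longrightarrow> \<exists>t s'. exec c s t s' \<and> s' 0 = encode (f x) \<and>
    (\<forall>y\<ge>N. s' y = s y) \<and> t \<le> poly p (esize x)"
  shows "ptime f"
  using assms unfolding ptime_def runs_def by blast

lemma runs_mono: "runs c N p f \<Longrightarrow> N \<le> M \<Longrightarrow> runs c M p f"
  unfolding runs_def by (meson order_trans)

text \<open>A program cannot write more than it pays for, so a bound on time is a bound on size.
  This allows the cost of an outer function, measured at an intermediate result, to be expressed in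
  the size of the original input.\<close>

lemma ptime_size_bound:
  fixes f :: "'a::encodable \<Rightarrow> 'b::encodable"
  assumes "ptime f"
  obtains p where "\<And>x. esize (f x) \<le> poly p (esize x)"
proof -
  obtain c N p where r: "runs c N p f"
    using assms by (auto simp: ptime_def)
  have "esize (f x) \<le> poly ([:0, 1:] + p) (esize x)" for x
  proof -
    obtain t s' where e: "exec c ((\<lambda>_. Lf)(0 := encode x)) t s'" "s' 0 = encode (f x)"
        "t \<le> poly p (esize x)"
      using runsE[OF r, of "(\<lambda>_. Lf)(0 := encode x)" x] fun_upd_same by metis
    show ?thesis
      using exec_size[OF e(1), of 0] e(2,3) by simp
  qed
  then show thesis using that by blast
qed

lemma ptime_exp:
  fixes f :: "'a::encodable \<Rightarrow> 'b::encodable"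
  assumes "\<And>s x. s 0 = encode x \<Longrightarrow> val e s = encode (f x) \<and> cost e s \<le> poly p (esize x)"
  shows "ptime f"
proof (rule runsI)
  fix s :: state and x :: 'a
  assume s: "s 0 = encode x"
  show "\<exists>t s'. exec (Assign 0 e) s t s' \<and> s' 0 = encode (f x) \<and>
    (\<forall>y\<ge>1. s' y = s y) \<and> t \<le> poly (1 + p) (esize x)"
    using assms[of s, OF s] exec.Assign[of 0 e s] by fastforce
qed

lemma ptime_comp:
  fixes f :: "'a::encodable \<Rightarrow> 'b::encodable" and g :: "'b \<Rightarrow> 'c::encodable"
  assumes "ptime g" "ptime f"
  shows "ptime (\<lambda>x. g (f x))"
proof -
  obtain c N p where r: "runs c N p f"
    using assms by (auto simp: ptime_def)
  obtain d M q where r': "runs d M q g"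
    using assms by (auto simp: ptime_def)
  obtain b where b: "\<And>x. esize (f x) \<le> poly b (esize x)"
    using assms ptime_size_bound by blast
  show ?thesis
  proof (rule runsI)
    fix s :: state and x :: 'a
    assume s: "s 0 = encode x"
    obtain t s' where 1: "exec c s t s'" "s' 0 = encode (f x)" "\<And>y. y \<ge> N \<Longrightarrow> s' y = s y"
      "t \<le> poly p (esize x)"
      using runsE[where s = s, OF r s] by blast
    obtain t' s'' where 2: "exec d s' t' s''" "s'' 0 = encode (g (f x))"
      "\<And>y. y \<ge> M \<Longrightarrow> s'' y = s' y" "t' \<le> poly q (esize (f x))"
      using runsE[where s = s', OF r' 1(2)] by blast
    have "t' \<le> poly q (poly b (esize x))"
      using 2(4) poly_nat_mono[OF b] order_trans by blast
    then show "\<exists>t s'. exec (Seq c d) s t s' \<and> s' 0 = encode (g (f x)) \<and>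
      (\<forall>y\<ge>max N M. s' y = s y) \<and> t \<le> poly (p + q \<circ>\<^sub>p b) (esize x)"
      using exec.Seq[OF 1(1) 2(1)] 1 2 by (auto simp: poly_pcompose intro!: exI[of _ "t + t'"] exI[of _ s''])
  qed
qed

text \<open>Variables that a program does not touch hold what has to survive it, so programs can be
  combined without renaming variables.\<close>

lemma ptime_Pair:
  fixes f :: "'a::encodable \<Rightarrow> 'b::encodable" and g :: "'a \<Rightarrow> 'c::encodable"
  assumes "ptime f" "ptime g"
  shows "ptime (\<lambda>x. (f x, g x))"
proof -
  obtain c N0 p where r0: "runs c N0 p f"
    using assms by (auto simp: ptime_def)
  obtain d M q where r0': "runs d M q g"
    using assms by (auto simp: ptime_def)
  define N where "N = Suc (max N0 M)"
  have r: "runs c N p f" and r': "runs d N q g"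
    using r0 r0' by (auto intro: runs_mono simp: N_def)
  obtain a where a: "\<And>x. esize (f x) \<le> poly a (esize x)"
    using assms ptime_size_bound by blast
  obtain b where b: "\<And>x. esize (g x) \<le> poly b (esize x)"
    using assms ptime_size_bound by blast
  define prog where "prog = Seq (Assign N (Var 0)) (Seq c (Seq (Assign (Suc N) (Var 0))
    (Seq (Assign 0 (Var N)) (Seq d (Assign 0 (ND (Var (Suc N)) (Var 0)))))))"
  show ?thesis
  proof (rule runsI)
    fix s :: state and x :: 'a
    assume s: "s 0 = encode x"
    define s1 where "s1 = s(N := encode x)"
    have e1: "exec (Assign N (Var 0)) s (Suc (Suc (esize x))) s1"
      using s
      by (intro exec_AssignI) (simp_all add: s1_def)
    have s1: "s1 0 = encode x" using s by (simp add: s1_def)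
    obtain t2 s2 where e2: "exec c s1 t2 s2" "s2 0 = encode (f x)" "\<And>y. y \<ge> N \<Longrightarrow> s2 y = s1 y"
      "t2 \<le> poly p (esize x)"
      using runsE[where s = s1, OF r s1] by blast
    define s3 where "s3 = s2(Suc N := encode (f x))"
    have e3: "exec (Assign (Suc N) (Var 0)) s2 (Suc (Suc (esize (f x)))) s3"
      using e2
      by (intro exec_AssignI) (simp_all add: s3_def)
    define s4 where "s4 = s3(0 := encode x)"
    have s3N: "s3 N = encode x" using e2 by (simp add: s3_def s1_def)
    have e4: "exec (Assign 0 (Var N)) s3 (Suc (Suc (esize x))) s4"
      using s3N
      by (intro exec_AssignI) (simp_all add: s4_def)
    have s4: "s4 0 = encode x" by (simp add: s4_def)
    obtain t5 s5 where e5: "exec d s4 t5 s5" "s5 0 = encode (g x)" "\<And>y. y \<ge> N \<Longrightarrow> s5 y = s4 y"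
      "t5 \<le> poly q (esize x)"
      using runsE[where s = s4, OF r' s4] by blast
    have s5: "s5 (Suc N) = encode (f x)" using e5 by (simp add: s4_def s3_def)
    define s6 where "s6 = s5(0 := encode (f x, g x))"
    have e6: "exec (Assign 0 (ND (Var (Suc N)) (Var 0))) s5
        (Suc (Suc (Suc (esize (f x)) + Suc (esize (g x))))) s6"
      using s5 e5
      by (intro exec_AssignI) (simp_all add: s6_def)
    have fr: "s6 y = s y" if "y \<ge> Suc (Suc N)" for y
      using that e5(3)[of y] e2(3)[of y] by (auto simp: s6_def s4_def s3_def s1_def N_def)
    have s6: "s6 0 = encode (f x, g x)" by (simp add: s6_def)
    have ex: "exec prog s (Suc (Suc (esize x)) + (t2 + (Suc (Suc (esize (f x))) + (Suc (Suc (esize x)) +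
       (t5 + (Suc (Suc (Suc (esize (f x)) + Suc (esize (g x))))))))))  s6"
      unfolding prog_def
      by (rule exec.Seq[OF e1 exec.Seq[OF e2(1) exec.Seq[OF e3 exec.Seq[OF e4 exec.Seq[OF e5(1) e6]]]]])
    show "\<exists>t s'. exec prog s t s' \<and> s' 0 = encode (f x, g x) \<and> (\<forall>y\<ge>Suc (Suc N). s' y = s y) \<and>
      t \<le> poly (10 + [:0, 2:] + p + q + 2 * a + b) (esize x)"
      using a[of x] b[of x] e2(4) e5(4)
      by - (rule exI, rule exI, rule conjI, rule ex, auto simp: fr s6 simp del: encode_simps)
  qed
qed

lemma ptime_if:
  fixes f g :: "'a::encodable \<Rightarrow> 'b::encodable"
  assumes "ptime b" "ptime f" "ptime g"
  shows "ptime (\<lambda>x. if b x then f x else g x)"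
proof -
  obtain c0 N0 p0 where r0: "runs c0 N0 p0 b"
    using assms by (auto simp: ptime_def)
  obtain c1 N1 p1 where r1: "runs c1 N1 p1 f"
    using assms by (auto simp: ptime_def)
  obtain c2 N2 p2 where r2: "runs c2 N2 p2 g"
    using assms by (auto simp: ptime_def)
  define N where "N = Suc (max N0 (max N1 N2))"
  have r: "runs c0 N p0 b" "runs c1 N p1 f" "runs c2 N p2 g"
    using r0 r1 r2 by (auto intro: runs_mono simp: N_def)
  define prog where "prog = Seq (Assign N (Var 0)) (Seq c0 (Cond (Var 0)
    (Seq (Assign 0 (Var N)) c1) (Seq (Assign 0 (Var N)) c2)))"
  show ?thesis
  proof (rule runsI)
    fix s :: state and x :: 'a
    assume s: "s 0 = encode x"
    define s1 where "s1 = s(N := encode x)"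
    have e1: "exec (Assign N (Var 0)) s (Suc (Suc (esize x))) s1"
      using s
      by (intro exec_AssignI) (simp_all add: s1_def)
    have s1: "s1 0 = encode x" using s by (simp add: s1_def)
    obtain t2 s2 where e2: "exec c0 s1 t2 s2" "s2 0 = encode (b x)" "\<And>y. y \<ge> N \<Longrightarrow> s2 y = s1 y"
      "t2 \<le> poly p0 (esize x)"
      using runsE[where s = s1, OF r(1) s1] by blast
    have s2N: "s2 N = encode x" using e2 by (simp add: s1_def)
    define s3 where "s3 = s2(0 := encode x)"
    have e3: "exec (Assign 0 (Var N)) s2 (Suc (Suc (esize x))) s3"
      using s2N
      by (intro exec_AssignI) (simp_all add: s3_def)
    have s3: "s3 0 = encode x" by (simp add: s3_def)
    obtain t4 s4 where e4: "exec c1 s3 t4 s4" "s4 0 = encode (f x)" "\<And>y. y \<ge> N \<Longrightarrow> s4 y = s3 y"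
      "t4 \<le> poly p1 (esize x)"
      using runsE[where s = s3, OF r(2) s3] by blast
    obtain t5 s5 where e5: "exec c2 s3 t5 s5" "s5 0 = encode (g x)" "\<And>y. y \<ge> N \<Longrightarrow> s5 y = s3 y"
      "t5 \<le> poly p2 (esize x)"
      using runsE[where s = s3, OF r(3) s3] by blast
    have c: "cost (Var 0) s2 \<le> 2" using e2(2) esize_bool_le[of "b x"] by simp
    show "\<exists>t s'. exec prog s t s' \<and> s' 0 = encode (if b x then f x else g x) \<and>
      (\<forall>y\<ge>Suc N. s' y = s y) \<and> t \<le> poly (10 + [:0, 2:] + p0 + p1 + p2) (esize x)"
    proof (cases "b x")
      case True
      have ex: "exec prog s (Suc (Suc (esize x)) + (t2 + (Suc (cost (Var 0) s2 + (Suc (Suc (esize x)) + t4))))) s4"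
        unfolding prog_def using True e2(2)
        by (intro exec.Seq[OF e1 exec.Seq[OF e2(1) exec.CondTrue[OF _ exec.Seq[OF e3 e4(1)]]]]) auto
      show ?thesis
        using True e2(3,4) e4(2-4) c
        by - (rule exI, rule exI, rule conjI, rule ex, auto simp: s3_def s1_def N_def simp del: cost.simps)
    next
      case False
      have ex: "exec prog s (Suc (Suc (esize x)) + (t2 + (Suc (cost (Var 0) s2 + (Suc (Suc (esize x)) + t5))))) s5"
        unfolding prog_def using False e2(2)
        by (intro exec.Seq[OF e1 exec.Seq[OF e2(1) exec.CondFalse[OF _ exec.Seq[OF e3 e5(1)]]]]) auto
      show ?thesis
        using False e2(3,4) e5(2-4) c
        by - (rule exI, rule exI, rule conjI, rule ex, auto simp: s3_def s1_def N_def simp del: cost.simps)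
    qed
  qed
qed

lemma ptime_id: "ptime (\<lambda>x. x)"
  by (rule ptime_exp[where e = "Var 0" and p = "[:1, 1:]"]) auto

lemma ptime_fst': "ptime (fst :: 'a::encodable \<times> 'b::encodable \<Rightarrow> 'a)"
  by (rule ptime_exp[where e = "LEFT (Var 0)" and p = "[:2, 1:]"]) auto

lemma ptime_snd': "ptime (snd :: 'a::encodable \<times> 'b::encodable \<Rightarrow> 'b)"
  by (rule ptime_exp[where e = "RIGHT (Var 0)" and p = "[:2, 1:]"]) auto

lemmas ptime_fst = ptime_comp[OF ptime_fst']
lemmas ptime_snd = ptime_comp[OF ptime_snd']

fun const_exp :: "btree \<Rightarrow> exp" where
  "const_exp Lf = LF"
| "const_exp (Nd a b) = ND (const_exp a) (const_exp b)"

lemma ptime_const: "ptime (\<lambda>x :: 'a::encodable. k)"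
proof (rule ptime_exp)
  fix s :: state and x :: 'a
  have "val (const_exp a) s = a" "cost (const_exp a) s = cost (const_exp a) (\<lambda>_. Lf)" for a
    by (induction a) auto
  then show "val (const_exp (encode k)) s = encode k \<and>
      cost (const_exp (encode k)) s \<le> poly [:cost (const_exp (encode k)) (\<lambda>_. Lf):] (esize x)"
    by simp
qed

lemma esize_take: "esize (take k l) \<le> esize l"
  by (induction l arbitrary: k) (auto simp: take_Cons split: nat.split intro: le_SucI add_mono)

lemma esize_nth: "a \<in> set l \<Longrightarrow> esize a \<le> esize l"
  by (induction l) auto

text \<open>The variables \<open>N\<close>, \<open>Suc N\<close> and \<open>Suc (Suc N)\<close> hold
  the parameter, the rest of the list and the accumulator. One round is charged for six trees of
  size at most \<open>B\<close> and for a call of \<open>c\<close> on a triple of size at most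
  \<open>3 * B + 2\<close>; the last summand covers the failing loop test.\<close>

lemma exec_fold_loop:
  assumes r: "runs c N p (\<lambda>(x, a, acc). g x a acc)" and "N > 0"
    and "s N = encode x" "s (Suc N) = encode l" "s (Suc (Suc N)) = encode acc"
    and "\<And>k. esize (fold (g x) (take k l) acc) \<le> B" "esize x \<le> B" "esize l \<le> B"
  shows "\<exists>t s'. exec (While (Var (Suc N)) (Seq (Assign 0 (ND (Var N) (ND (LEFT (Var (Suc N))) (Var (Suc (Suc N))))))
      (Seq c (Seq (Assign (Suc (Suc N)) (Var 0)) (Assign (Suc N) (RIGHT (Var (Suc N)))))))) s t s' \<and>
      s' (Suc (Suc N)) = encode (fold (g x) l acc) \<and> (\<forall>y\<ge>N + 3. s' y = s y) \<and>
      t \<le> length l * (6 * B + 20 + poly p (3 * B + 2)) + B + 2"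
  (is "\<exists>t s'. exec ?loop s t s' \<and> _")
  using assms(3-8)
proof (induction l arbitrary: s acc)
  case Nil
  then show ?case
    using exec.WhileFalse[of "Var (Suc N)" s] by (fastforce simp: le_add2)
next
  case (Cons a l)
  have acc: "esize acc \<le> B" using Cons.prems(4)[of 0] by simp
  have gB: "esize (g x a acc) \<le> B" using Cons.prems(4)[of 1] by simp
  have al: "esize a + esize l < B" using Cons.prems(6) by simp
  define s1 where "s1 = s(0 := encode (x, a, acc))"
  have e1: "exec (Assign 0 (ND (Var N) (ND (LEFT (Var (Suc N))) (Var (Suc (Suc N)))))) s
      (7 + esize x + esize (a # l) + esize acc) s1"
    using Cons.prems(1-3)
      by (intro exec_AssignI) (simp_all add: s1_def eval_nat_numeral add_ac)
  have s1: "s1 0 = encode (x, a, acc)" by (simp add: s1_def)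
  obtain t2 s2 where e2: "exec c s1 t2 s2" "s2 0 = encode (g x a acc)" "\<And>y. y \<ge> N \<Longrightarrow> s2 y = s1 y"
      "t2 \<le> poly p (esize (x, a, acc))"
    using runsE[where s = s1, OF r s1] by auto
  have "esize (x, a, acc) \<le> 3 * B + 2" using acc al Cons.prems(5) by simp
  then have t2: "t2 \<le> poly p (3 * B + 2)" using e2(4) poly_nat_mono order_trans by blast
  define s3 where "s3 = s2(Suc (Suc N) := encode (g x a acc))"
  have e3: "exec (Assign (Suc (Suc N)) (Var 0)) s2 (2 + esize (g x a acc)) s3"
    using e2(2)
      by (intro exec_AssignI) (simp_all add: s3_def)
  have s3: "s3 (Suc N) = encode (a # l)" "s3 N = encode x"
    using e2(3)[of "Suc N"] e2(3)[of N] Cons.prems(1,2) \<open>N > 0\<close> by (auto simp: s3_def s1_def)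
  define s4 where "s4 = s3(Suc N := encode l)"
  have e4: "exec (Assign (Suc N) (RIGHT (Var (Suc N)))) s3 (3 + esize (a # l)) s4"
    using s3
      by (intro exec_AssignI) (simp_all add: s4_def)
  have "\<exists>t s'. exec ?loop s4 t s' \<and>
      s' (Suc (Suc N)) = encode (fold (g x) l (g x a acc)) \<and> (\<forall>y\<ge>N + 3. s' y = s4 y) \<and>
      t \<le> length l * (6 * B + 20 + poly p (3 * B + 2)) + B + 2"
  proof (rule Cons.IH)
    show "esize (fold (g x) (take k l) (g x a acc)) \<le> B" for k
      using Cons.prems(4)[of "Suc k"] by simp
  qed (use s3 al Cons.prems(5) in \<open>auto simp: s4_def s3_def\<close>)
  then obtain t5 s5 where e5: "exec ?loop s4 t5 s5"
      "s5 (Suc (Suc N)) = encode (fold (g x) l (g x a acc))" "\<And>y. y \<ge> N + 3 \<Longrightarrow> s5 y = s4 y"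
      "t5 \<le> length l * (6 * B + 20 + poly p (3 * B + 2)) + B + 2"
    by blast
  have ex: "exec ?loop s (Suc (cost (Var (Suc N)) s + (7 + esize x + esize (a # l) + esize acc +
      (t2 + (2 + esize (g x a acc) + (3 + esize (a # l))))) + t5)) s5"
    using Cons.prems(2)
    by (intro exec.WhileTrue[OF _ exec.Seq[OF e1 exec.Seq[OF e2(1) exec.Seq[OF e3 e4]]] e5(1)]) auto
  show ?case
    using e5(2-4) t2 acc gB al Cons.prems(2,5) e2(3)
    by - (rule exI, rule exI, rule conjI, rule ex, auto simp: s4_def s3_def s1_def)
qed

text \<open>The bound \<open>q\<close> on all intermediate accumulators excludes blow-up: a step
  that doubles a tree is cheap, but its iteration yields exponentially large trees.\<close>

lemma ptime_fold:
  fixes g :: "'a::encodable \<Rightarrow> 'b::encodable \<Rightarrow> 'c::encodable \<Rightarrow> 'c"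
  assumes g: "ptime (\<lambda>(x, a, acc). g x a acc)" and l: "ptime l" and s0: "ptime s0"
    and q: "\<And>x k. esize (fold (g x) (take k (l x)) (s0 x)) \<le> poly q (esize x)"
  shows "ptime (\<lambda>x. fold (g x) (l x) (s0 x))"
proof -
  obtain c0 N0 p0 where r0: "runs c0 N0 p0 (\<lambda>x. (x, l x, s0 x))"
    using ptime_Pair[OF ptime_id ptime_Pair[OF l s0]] by (auto simp: ptime_def)
  obtain c N1 p where r1: "runs c N1 p (\<lambda>(x, a, acc). g x a acc)"
    using g by (auto simp: ptime_def)
  define N where "N = Suc (max N0 N1)"
  have r: "runs c0 N p0 (\<lambda>x. (x, l x, s0 x))" "runs c N p (\<lambda>(x, a, acc). g x a acc)" "N > 0"
    using r0 r1 by (auto intro: runs_mono simp: N_def)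
  obtain pl where pl: "\<And>x. esize (l x) \<le> poly pl (esize x)"
    using l ptime_size_bound by blast
  define loop where "loop = While (Var (Suc N))
    (Seq (Assign 0 (ND (Var N) (ND (LEFT (Var (Suc N))) (Var (Suc (Suc N))))))
      (Seq c (Seq (Assign (Suc (Suc N)) (Var 0)) (Assign (Suc N) (RIGHT (Var (Suc N)))))))"
  define prog where "prog = Seq c0 (Seq (Assign N (LEFT (Var 0)))
    (Seq (Assign (Suc N) (LEFT (RIGHT (Var 0)))) (Seq (Assign (Suc (Suc N)) (RIGHT (RIGHT (Var 0))))
      (Seq loop (Assign 0 (Var (Suc (Suc N))))))))"
  define b where "b = [:0, 1:] + pl + q"
  show ?thesis
  proof (rule runsI)
    fix s :: state and x :: 'a
    assume s: "s 0 = encode x"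
    obtain t1 s1 where e1: "exec c0 s t1 s1" "s1 0 = encode (x, l x, s0 x)"
      "\<And>y. y \<ge> N \<Longrightarrow> s1 y = s y" "t1 \<le> poly p0 (esize x)"
      using runsE[where s = s, OF r(1) s] by blast
    define B where "B = poly b (esize x)"
    have B: "esize x \<le> B" "esize (l x) \<le> B" "\<And>k. esize (fold (g x) (take k (l x)) (s0 x)) \<le> B"
      using pl[of x] q[of x] by (auto simp: B_def b_def intro: trans_le_add2)
    have B': "esize (s0 x) \<le> B" "esize (fold (g x) (l x) (s0 x)) \<le> B"
      using B(3)[of 0] B(3)[of "length (l x)"] by auto
    have z: "esize (x, l x, s0 x) \<le> 3 * B + 2" using B B' by simp
    define s2 where "s2 = s1(N := encode x)"
    have e2: "exec (Assign N (LEFT (Var 0))) s1 (3 + esize (x, l x, s0 x)) s2"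
      using e1(2)
      by (intro exec_AssignI) (simp_all add: s2_def)
    define s3 where "s3 = s2(Suc N := encode (l x))"
    have e3: "exec (Assign (Suc N) (LEFT (RIGHT (Var 0)))) s2 (4 + esize (x, l x, s0 x)) s3"
      using e1(2) r(3)
      by (intro exec_AssignI) (simp_all add: s2_def s3_def)
    define s4 where "s4 = s3(Suc (Suc N) := encode (s0 x))"
    have e4: "exec (Assign (Suc (Suc N)) (RIGHT (RIGHT (Var 0)))) s3 (4 + esize (x, l x, s0 x)) s4"
      using e1(2) r(3)
      by (intro exec_AssignI) (simp_all add: s2_def s3_def s4_def)
    obtain t5 s5 where e5: "exec loop s4 t5 s5"
      "s5 (Suc (Suc N)) = encode (fold (g x) (l x) (s0 x))" "\<And>y. y \<ge> N + 3 \<Longrightarrow> s5 y = s4 y"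
      "t5 \<le> length (l x) * (6 * B + 20 + poly p (3 * B + 2)) + B + 2"
      using exec_fold_loop[OF r(2,3), of s4 x "l x" "s0 x" B] B
      by (auto simp: loop_def s4_def s3_def s2_def)
    have t5: "t5 \<le> B * (6 * B + 20 + poly p (3 * B + 2)) + B + 2"
      using e5(4) mult_le_mono1[OF order_trans[OF length_le_esize[of "l x"] B(2)]] 
      by (meson add_le_mono1 order_trans)
    define s6 where "s6 = s5(0 := encode (fold (g x) (l x) (s0 x)))"
    have e6: "exec (Assign 0 (Var (Suc (Suc N)))) s5 (2 + esize (fold (g x) (l x) (s0 x))) s6"
      using e5(2)
      by (intro exec_AssignI) (simp_all add: s6_def)
    have ex: "exec prog s (t1 + ((3 + esize (x, l x, s0 x)) + ((4 + esize (x, l x, s0 x)) +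
      ((4 + esize (x, l x, s0 x)) + (t5 + (2 + esize (fold (g x) (l x) (s0 x)))))))) s6"
      unfolding prog_def
      by (rule exec.Seq[OF e1(1) exec.Seq[OF e2 exec.Seq[OF e3 exec.Seq[OF e4 exec.Seq[OF e5(1) e6]]]]])
    have "poly (p0 + 30 + 11 * b + b * (6 * b + 20 + p \<circ>\<^sub>p (3 * b + 2))) (esize x) =
      poly p0 (esize x) + 30 + 11 * B + B * (6 * B + 20 + poly p (3 * B + 2))"
      by (simp add: poly_pcompose B_def)
    moreover have "s6 y = s y" if "y \<ge> N + 3" for y
      using that e5(3)[of y] e1(3)[of y] r(3) by (auto simp: s6_def s4_def s3_def s2_def)
    ultimately show "\<exists>t s'. exec prog s t s' \<and> s' 0 = encode (fold (g x) (l x) (s0 x)) \<and>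
      (\<forall>y\<ge>N + 3. s' y = s y) \<and>
      t \<le> poly (p0 + 30 + 11 * b + b * (6 * b + 20 + p \<circ>\<^sub>p (3 * b + 2))) (esize x)"
      using z t5 B' e1(4) by - (rule exI, rule exI, rule conjI, rule ex, auto simp: s6_def simp del: encode_simps)
  qed
qed


section \<open>Booleans, numbers and lists\<close>

named_theorems ptime_intros

lemmas [ptime_intros] = ptime_id ptime_const ptime_fst ptime_snd ptime_Pair ptime_if

text \<open>Several arguments are passed through \<open>fst\<close> and \<open>snd\<close> instead
  of patterns. Instantiating \<open>h\<close> then yields a rule that is selected by the outermost
  function symbol, so that unfolding a definition and applying \<open>ptime_intros\<close> settles
  most functions.\<close>

lemma ptime_comp2:
  assumes "ptime (\<lambda>p. h (fst p) (snd p))" "ptime f" "ptime g"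
  shows "ptime (\<lambda>x. h (f x) (g x))"
  using ptime_comp[OF assms(1) ptime_Pair[OF assms(2,3)]] by simp

lemma ptime_comp3:
  assumes "ptime (\<lambda>p. h (fst p) (fst (snd p)) (snd (snd p)))" "ptime f" "ptime g" "ptime k"
  shows "ptime (\<lambda>x. h (f x) (g x) (k x))"
  using ptime_comp[OF assms(1) ptime_Pair[OF assms(2) ptime_Pair[OF assms(3,4)]]] by simp

text \<open>This is the only test of the machine. Comparison with \<open>[]\<close> and with
  \<open>0\<close> are instances of it, as both are encoded by a leaf.\<close>

lemma ptime_is_Lf: "ptime (\<lambda>x. encode x = Lf)"
proof (rule runsI)
  fix s :: state and x :: 'a
  assume s: "s 0 = encode x"
  define prog where "prog = Cond (Var 0) (Assign 0 LF) (Assign 0 (ND LF LF))"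
  show "\<exists>t s'. exec prog s t s' \<and> s' 0 = encode (encode x = Lf) \<and> (\<forall>y\<ge>1. s' y = s y) \<and>
    t \<le> poly [:6, 1:] (esize x)"
  proof (cases "encode x = Lf")
    case True
    have ex: "exec prog s (Suc (cost (Var 0) s + 4)) (s(0 := Nd Lf Lf))"
      unfolding prog_def using True s by (intro exec.CondFalse exec_AssignI) auto
    show ?thesis
      using True s by - (rule exI, rule exI, rule conjI, rule ex, auto)
  next
    case False
    have ex: "exec prog s (Suc (cost (Var 0) s + 2)) (s(0 := Lf))"
      unfolding prog_def using False s by (intro exec.CondTrue exec_AssignI) auto
    show ?thesis
      using False s by - (rule exI, rule exI, rule conjI, rule ex, auto)
  qed
qed

lemma ptime_Nil_eq [ptime_intros]: "ptime f \<Longrightarrow> ptime (\<lambda>x. f x = ([] :: 'a::encodable list))"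
  using ptime_comp[OF ptime_is_Lf, of f] by simp

lemma ptime_0_eq [ptime_intros]: "ptime f \<Longrightarrow> ptime (\<lambda>x. f x = (0 :: nat))"
  using ptime_comp[OF ptime_is_Lf, of f] by simp

lemma ptime_not [ptime_intros]:
  assumes "ptime b"
  shows "ptime (\<lambda>x. \<not> b x)"
proof -
  have "ptime (\<lambda>x. if b x then False else True)"
    by (intro ptime_if ptime_const assms)
  moreover have "(if b x then False else True) = (\<not> b x)" for x
    by simp
  ultimately show ?thesis by (simp only:)
qed

lemma ptime_conj [ptime_intros]:
  assumes "ptime b" "ptime c"
  shows "ptime (\<lambda>x. b x \<and> c x)"
proof -
  have "ptime (\<lambda>x. if b x then c x else False)"
    by (intro ptime_if ptime_const assms)
  moreover have "(if b x then c x else False) = (b x \<and> c x)" for x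
    by simp
  ultimately show ?thesis by (simp only:)
qed

lemma ptime_disj [ptime_intros]:
  assumes "ptime b" "ptime c"
  shows "ptime (\<lambda>x. b x \<or> c x)"
proof -
  have "ptime (\<lambda>x. if b x then True else c x)"
    by (intro ptime_if ptime_const assms)
  moreover have "(if b x then True else c x) = (b x \<or> c x)" for x
    by simp
  ultimately show ?thesis by (simp only:)
qed

lemma ptime_iff [ptime_intros]:
  assumes "ptime b" "ptime c"
  shows "ptime (\<lambda>x. b x = (c x :: bool))"
proof -
  have "ptime (\<lambda>x. if b x then c x else \<not> c x)"
    by (intro ptime_if ptime_not assms)
  moreover have "(if b x then c x else \<not> c x) = (b x = c x)" for x
    by simp
  ultimately show ?thesis by (simp only:)
qed

lemma ptime_Cons [ptime_intros]: "ptime f \<Longrightarrow> ptime g \<Longrightarrow> ptime (\<lambda>x. f x # g x)"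
  by (rule ptime_comp2[OF ptime_exp[where e = "Var 0" and p = "[:1, 1:]"]]) (auto simp: encode_prod_def)

lemma ptime_Suc [ptime_intros]: "ptime f \<Longrightarrow> ptime (\<lambda>x. Suc (f x))"
  by (rule ptime_comp[OF ptime_exp[where e = "ND LF (Var 0)" and p = "[:3, 1:]"]]) auto

lemma right_encode_list: "right (encode xs) = encode (tl xs)"
  by (cases xs) auto

lemma right_encode_nat: "right (encode n) = encode (n - 1 :: nat)"
  by (cases n) auto

lemma ptime_tl [ptime_intros]: "ptime f \<Longrightarrow> ptime (\<lambda>x. tl (f x))"
  by (rule ptime_comp[OF ptime_exp[where e = "RIGHT (Var 0)" and p = "[:2, 1:]"]])
    (auto simp: right_encode_list)

lemma ptime_pred: "ptime f \<Longrightarrow> ptime (\<lambda>x. f x - 1 :: nat)"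
  by (rule ptime_comp[OF ptime_exp[where e = "RIGHT (Var 0)" and p = "[:2, 1:]"]])
    (auto simp: right_encode_nat[unfolded One_nat_def])

text \<open>\<open>False\<close> and a unary digit are the same leaf, so the tree of a number
  already is the tree of this list. Folding over it repeats a step a given number of times.\<close>

lemma ptime_unary:
  assumes "ptime f"
  shows "ptime (\<lambda>x. replicate (f x) False)"
proof -
  have e: "encode n = encode (replicate n False)" for n
    by (induction n) auto
  have "ptime (\<lambda>n. replicate n False)"
    by (rule ptime_exp[where e = "Var 0" and p = "[:1, 1:]"]) (simp add: e)
  from ptime_comp[OF this assms] show ?thesis .
qed

text \<open>The machine yields \<open>Lf\<close> on the left of \<open>Lf\<close>, whereas
  \<open>hd []\<close> is unspecified. A default that is encoded by \<open>Lf\<close> makes the two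
  agree on all lists.\<close>

definition hd_or :: "'a \<Rightarrow> 'a list \<Rightarrow> 'a" where
  "hd_or d xs = (case xs of [] \<Rightarrow> d | x # _ \<Rightarrow> x)"

lemma hd_or_simps [simp]: "hd_or d [] = d" "hd_or d (x # xs) = x"
  by (simp_all add: hd_or_def)

lemma ptime_hd_or:
  assumes "encode d = Lf" "ptime f"
  shows "ptime (\<lambda>x. hd_or d (f x))"
proof -
  have e: "left (encode xs) = encode (hd_or d xs)" for xs
    using assms(1) by (cases xs) auto
  have "ptime (hd_or d)"
    by (rule ptime_exp[where e = "LEFT (Var 0)" and p = "[:2, 1:]"]) (simp add: e)
  from ptime_comp[OF this assms(2)] show ?thesis .
qed

lemmas [ptime_intros] = ptime_hd_or[where d = False, simplified] ptime_hd_or[where d = "[]", simplified]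

lemma esize_append [simp]: "esize (xs @ ys) = esize xs + esize ys"
  by (induction xs) auto

lemma esize_filter_le: "esize (filter P xs) \<le> esize xs"
  by (induction xs) auto

lemma esize_le_length:
  assumes "\<And>a. a \<in> set xs \<Longrightarrow> esize a \<le> b"
  shows "esize xs \<le> length xs * Suc b"
  using assms
proof (induction xs)
  case (Cons a xs)
  then show ?case using add_mono[of "esize a" b "esize xs" "length xs * Suc b"] by simp
qed simp

text \<open>The increment allowed per step does not depend on the accumulator, so the increments
  along the list only add up and cannot compound.\<close>

lemma ptime_fold_additive:
  fixes g :: "'a::encodable \<Rightarrow> 'b::encodable \<Rightarrow> 'c::encodable \<Rightarrow> 'c"
  assumes g: "ptime (\<lambda>p. g (fst p) (fst (snd p)) (snd (snd p)))" and l: "ptime l" and s0: "ptime s0"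
    and q: "\<And>x a acc. esize (g x a acc) \<le> esize acc + poly q (esize x + esize a)"
  shows "ptime (\<lambda>x. fold (g x) (l x) (s0 x))"
proof -
  obtain pl where pl: "\<And>x. esize (l x) \<le> poly pl (esize x)"
    using l ptime_size_bound by blast
  obtain ps where ps: "\<And>x. esize (s0 x) \<le> poly ps (esize x)"
    using s0 ptime_size_bound by blast
  show ?thesis
  proof (rule ptime_fold[OF _ l s0])
    show "ptime (\<lambda>(x, a, acc). g x a acc)"
      unfolding case_prod_beta by (rule g)
    fix x k
    have *: "esize (fold (g x) xs s) \<le> esize s + length xs * poly q (esize x + esize (l x))"
      if "set xs \<subseteq> set (l x)" for xs s
      using that
    proof (induction xs arbitrary: s)
      case (Cons a xs)
      have "esize (g x a s) \<le> esize s + poly q (esize x + esize (l x))"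
        using q[of x a s] poly_nat_mono[of "esize x + esize a" "esize x + esize (l x)" q]
          esize_nth[of a "l x"] Cons.prems by fastforce
      with Cons.IH[of "g x a s"] Cons.prems show ?case by simp
    qed simp
    have "esize (fold (g x) (take k (l x)) (s0 x)) \<le>
        esize (s0 x) + length (take k (l x)) * poly q (esize x + esize (l x))"
      by (rule *) (rule set_take_subset)
    also have "\<dots> \<le> poly ps (esize x) + poly pl (esize x) * poly q (esize x + poly pl (esize x))"
      using ps[of x] pl[of x] length_le_esize[of "l x"]
      by (intro add_mono mult_mono poly_nat_mono) auto
    also have "\<dots> = poly (ps + pl * (q \<circ>\<^sub>p ([:0, 1:] + pl))) (esize x)"
      by (simp add: poly_pcompose)
    finally show "esize (fold (g x) (take k (l x)) (s0 x)) \<le>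
      poly (ps + pl * (q \<circ>\<^sub>p ([:0, 1:] + pl))) (esize x)" .
  qed
qed

text \<open>Subtraction is iterated predecessor. As it is truncated at zero, equality and order of
  numbers become tests for zero.\<close>

lemma ptime_diff [ptime_intros]:
  assumes "ptime f" "ptime g"
  shows "ptime (\<lambda>x. f x - g x :: nat)"
proof -
  have *: "fold (\<lambda>_ s. s - 1) (replicate n False) m = m - n" for m n :: nat
    by (induction n arbitrary: m) auto
  have "ptime (\<lambda>x. fold (\<lambda>_ s. s - 1) (replicate (g x) False) (f x))"
    by (rule ptime_fold_additive[where q = 0]; (intro assms ptime_unary ptime_pred ptime_intros)?; simp)
  then show ?thesis by (simp only: *)
qed

lemma ptime_nat_eq [ptime_intros]:
  assumes "ptime f" "ptime g"
  shows "ptime (\<lambda>x. f x = (g x :: nat))"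
proof -
  have "ptime (\<lambda>x. f x - g x = 0 \<and> g x - f x = 0)"
    by (intro ptime_intros assms)
  moreover have "(f x - g x = 0 \<and> g x - f x = 0) = (f x = g x)" for x
    by auto
  ultimately show ?thesis by simp
qed

lemma ptime_nat_less [ptime_intros]:
  assumes "ptime f" "ptime g"
  shows "ptime (\<lambda>x. f x < (g x :: nat))"
proof -
  have "ptime (\<lambda>x. \<not> (g x - f x = 0))"
    by (intro ptime_intros assms)
  then show ?thesis by (simp add: not_le)
qed

lemma ptime_drop [ptime_intros]:
  assumes "ptime f" "ptime g"
  shows "ptime (\<lambda>x. drop (f x) (g x))"
proof -
  have *: "fold (\<lambda>_ s. tl s) (replicate n False) xs = drop n xs" for n and xs :: "'b list"
    by (induction n arbitrary: xs) (auto simp: drop_Suc)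
  have "esize (tl xs) \<le> esize xs" for xs :: "'b list"
    by (cases xs) auto
  then show ?thesis
    unfolding *[symmetric]
    by (intro ptime_fold_additive[where q = 0]; (intro assms ptime_unary ptime_intros)?; simp)
qed

lemma ptime_length [ptime_intros]:
  assumes "ptime f"
  shows "ptime (\<lambda>x. length (f x))"
proof -
  have "fold (\<lambda>_ s. Suc s) xs m = length xs + m" for m and xs :: "'b list"
    by (induction xs arbitrary: m) auto
  then have *: "fold (\<lambda>_ s. Suc s) xs 0 = length xs" for xs :: "'b list"
    by simp
  show ?thesis
    unfolding *[symmetric]
    by (rule ptime_fold_additive[where q = 1]; (intro assms ptime_intros)?; simp)
qed

lemma ptime_rev [ptime_intros]:
  assumes "ptime f"
  shows "ptime (\<lambda>x. rev (f x))"
  unfolding rev_conv_fold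
  by (rule ptime_fold_additive[where q = "[:1, 1:]"]; (intro assms ptime_intros)?; simp)

lemma ptime_append [ptime_intros]:
  assumes "ptime f" "ptime g"
  shows "ptime (\<lambda>x. f x @ g x)"
proof -
  have "fold Cons (rev xs) ys = xs @ ys" for xs ys :: "'b list"
    by (metis fold_Cons_rev rev_rev_ident)
  then have *: "xs @ ys = fold Cons (rev xs) ys" for xs ys :: "'b list"
    by simp
  show ?thesis
    unfolding *
    by (rule ptime_fold_additive[where q = "[:1, 1:]"]; (intro assms ptime_intros)?; simp)
qed

text \<open>The mapped function may depend on the whole input \<open>x\<close>, which acts as its
  environment; therefore its own bound is required on pairs.\<close>

lemma ptime_map [ptime_intros]:
  fixes f :: "'a::encodable \<Rightarrow> 'b::encodable \<Rightarrow> 'c::encodable"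
  assumes f: "ptime (\<lambda>p. f (fst p) (snd p))" and l: "ptime l"
  shows "ptime (\<lambda>x. map (f x) (l x))"
proof -
  obtain q where q: "\<And>p. esize (f (fst p) (snd p)) \<le> poly q (esize p)"
    using f ptime_size_bound[of "\<lambda>p. f (fst p) (snd p)"] by blast
  have "fold (\<lambda>a s. f x a # s) xs s = rev (map (f x) xs) @ s" for x xs s
    by (induction xs arbitrary: s) auto
  then have *: "map (f x) xs = rev (fold (\<lambda>a s. f x a # s) xs [])" for x xs
    by simp
  show ?thesis
    unfolding *
  proof (intro ptime_rev ptime_fold_additive[where q = "1 + q \<circ>\<^sub>p [:1, 1:]"] l)
    show "ptime (\<lambda>p. f (fst p) (fst (snd p)) # snd (snd p))"
      by (intro ptime_intros ptime_comp2[OF f])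
    show "esize (f x a # s) \<le> esize s + poly (1 + q \<circ>\<^sub>p [:1, 1:]) (esize x + esize a)" for x a s
      using q[of "(x, a)"] by (simp add: poly_pcompose)
  qed (rule ptime_intros)
qed

lemma ptime_filter [ptime_intros]:
  assumes f: "ptime (\<lambda>p. f (fst p) (snd p))" and l: "ptime l"
  shows "ptime (\<lambda>x. filter (f x) (l x))"
proof -
  have "fold (\<lambda>a s. if f x a then a # s else s) xs s = rev (filter (f x) xs) @ s" for x xs s
    by (induction xs arbitrary: s) auto
  then have *: "filter (f x) xs = rev (fold (\<lambda>a s. if f x a then a # s else s) xs [])" for x xs
    by simp
  show ?thesis
    unfolding *
  proof (intro ptime_rev ptime_fold_additive[where q = "[:1, 1:]"] l)
    show "ptime (\<lambda>p. if f (fst p) (fst (snd p)) then fst (snd p) # snd (snd p) else snd (snd p))"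
      by (intro ptime_intros ptime_comp2[OF f])
  qed (simp_all add: ptime_const)
qed

lemma ptime_concat [ptime_intros]:
  assumes "ptime f"
  shows "ptime (\<lambda>x. concat (f x))"
proof -
  have "fold (\<lambda>a s. s @ a) xs s = s @ concat xs" for s and xs :: "'b list list"
    by (induction xs arbitrary: s) auto
  then have *: "concat xs = fold (\<lambda>a s. s @ a) xs []" for xs :: "'b list list"
    by simp
  show ?thesis
    unfolding *
    by (rule ptime_fold_additive[where q = "[:1, 1:]"]; (intro assms ptime_intros)?; simp)
qed

lemma ptime_list_ex [ptime_intros]:
  assumes f: "ptime (\<lambda>p. f (fst p) (snd p))" and l: "ptime l"
  shows "ptime (\<lambda>x. list_ex (f x) (l x))"
proof -
  have "fold (\<lambda>a s. s \<or> f x a) xs s \<longleftrightarrow> s \<or> list_ex (f x) xs" for x xs s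
    by (induction xs arbitrary: s) auto
  then have *: "list_ex (f x) xs = fold (\<lambda>a s. s \<or> f x a) xs False" for x xs
    by simp
  show ?thesis
    unfolding *
  proof (intro ptime_fold_additive[where q = 1] l)
    show "ptime (\<lambda>p. snd (snd p) \<or> f (fst p) (fst (snd p)))"
      by (intro ptime_intros ptime_comp2[OF f])
  qed (use esize_bool_le in \<open>auto simp: ptime_const intro: order_trans\<close>)
qed

lemma ptime_list_all [ptime_intros]:
  assumes f: "ptime (\<lambda>p. f (fst p) (snd p))" and l: "ptime l"
  shows "ptime (\<lambda>x. list_all (f x) (l x))"
proof -
  have "list_all P xs \<longleftrightarrow> \<not> list_ex (\<lambda>a. \<not> P a) xs" for P and xs :: "'b list"
    by (induction xs) auto
  then show ?thesis
    by (simp only:) (intro ptime_intros assms)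
qed

lemma ptime_mem_nat [ptime_intros]:
  assumes "ptime f" "ptime l"
  shows "ptime (\<lambda>x. (f x :: nat) \<in> set (l x))"
proof -
  have "v \<in> set xs \<longleftrightarrow> list_ex (\<lambda>u. v = u) xs" for v :: nat and xs
    by (induction xs) auto
  then show ?thesis
    by (simp only:) (intro ptime_intros assms ptime_comp[OF assms(1)])
qed

lemma ptime_take1 [ptime_intros]:
  assumes "ptime f"
  shows "ptime (\<lambda>x. take 1 (f x))"
proof -
  have "fold (\<lambda>a s. if s = [] then [a] else s) xs s = (if s = [] then take 1 xs else s)"
    for s and xs :: "'b list"
    by (induction xs arbitrary: s) auto
  then have *: "take 1 xs = fold (\<lambda>a s. if s = [] then [a] else s) xs []" for xs :: "'b list"
    by simp
  show ?thesis
    unfolding *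
    by (rule ptime_fold_additive[where q = "[:1, 1:]"]; (intro assms ptime_intros)?; simp)
qed

lemma ptime_replicate [ptime_intros]:
  assumes "ptime f" "ptime g"
  shows "ptime (\<lambda>x. replicate (f x) (g x))"
proof -
  have "replicate n a = map (\<lambda>_. a) (replicate n False)" for n and a :: 'b
    by (simp add: map_replicate_const)
  then show ?thesis
    by (simp only:) (intro ptime_intros assms ptime_unary ptime_comp[OF assms(2)])
qed

text \<open>The length of the list built so far is the next number. The increment thus depends on
  the accumulator, and the bound comes from knowing the intermediate lists: at most
  \<open>f x\<close> entries, each of size at most \<open>f x\<close> plus one node.\<close>

lemma ptime_upt [ptime_intros]:
  assumes "ptime f"
  shows "ptime (\<lambda>x. [0..<f x])"
proof -
  have *: "fold (\<lambda>_ s. length s # s) (replicate n False) [] = rev [0..<n]" for n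
  proof (induction n)
    case (Suc n)
    have "replicate (Suc n) False = replicate n False @ [False]"
      by (simp add: replicate_append_same)
    then show ?case using Suc by (simp del: replicate_Suc)
  qed simp
  then have **: "[0..<n] = rev (fold (\<lambda>_ s. length s # s) (replicate n False) [])" for n
    by simp
  obtain q where q: "\<And>x. esize (f x) \<le> poly q (esize x)"
    using ptime_size_bound[OF assms] by blast
  show ?thesis
    unfolding **
  proof (intro ptime_rev ptime_fold[where q = "q * (1 + q)"])
    show "ptime (\<lambda>(x :: 'a, a :: bool, s :: nat list). length s # s)"
      unfolding case_prod_beta by (intro ptime_intros)
    fix x and k
    have "take k (replicate (f x) False) = replicate (min k (f x)) False"
      by simp
    moreover have "esize (rev [0..<min k (f x)]) \<le> length (rev [0..<min k (f x)]) * Suc (f x)"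
      by (intro esize_le_length) auto
    moreover have "\<dots> \<le> poly (q * (1 + q)) (esize x)"
      using q[of x] by (simp only: poly_mult poly_add poly_1) (intro mult_mono, auto)
    ultimately show "esize (fold (\<lambda>_ s. length s # s) (take k (replicate (f x) False)) [])
        \<le> poly (q * (1 + q)) (esize x)"
      by (simp add: * del: fold_replicate)
  qed (intro ptime_intros ptime_unary assms)+
qed


section \<open>The algorithm\<close>

definition entry :: "bool list list \<Rightarrow> nat \<Rightarrow> nat \<Rightarrow> bool" where
  "entry M u v = hd_or False (drop v (hd_or [] (drop u M)))"

definition linked :: "bool list list \<Rightarrow> nat \<Rightarrow> nat \<Rightarrow> bool" where
  "linked M u v \<longleftrightarrow> entry M u v \<or> entry M v u"

definition unvisited :: "nat \<Rightarrow> nat list list \<Rightarrow> nat list" where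
  "unvisited n ls = filter (\<lambda>v. v \<notin> set (concat ls)) [0..<n]"

definition frontier :: "bool list list \<Rightarrow> nat list list \<Rightarrow> nat list" where
  "frontier M ls = filter (\<lambda>v. list_ex (\<lambda>u. linked M u v) (hd_or [] ls)) (unvisited (length M) ls)"

definition next_layer :: "bool list list \<Rightarrow> nat list list \<Rightarrow> nat list" where
  "next_layer M ls = (if frontier M ls = [] then take 1 (unvisited (length M) ls) else frontier M ls)"

text \<open>The most recent layer comes first; the list ends with an empty layer, which starts the
  search.\<close>

definition layers :: "bool list list \<Rightarrow> nat list list" where
  "layers M = fold (\<lambda>_ ls. next_layer M ls # ls) [0..<length M] [[]]"

text \<open>Sets of vertices are strictly increasing lists, so that each set is enumerated once.\<close>

definition grow :: "nat list \<Rightarrow> nat list list \<Rightarrow> nat list list" where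
  "grow L X = [] # concat (map (\<lambda>v. map (\<lambda>A. v # A) (filter (\<lambda>A. list_all (\<lambda>u. v < u) A) X)) L)"

definition small_subsets :: "nat list \<Rightarrow> nat list list" where
  "small_subsets L = grow L (grow L (grow L (grow L [[]])))"

text \<open>\<open>A\<close>, \<open>B\<close>, \<open>C\<close> are the traces of a candidate kernel on the layer before \<open>L\<close>, on \<open>L\<close> and on the
  layer after \<open>L\<close>.\<close>

definition locally_kernel ::
    "bool list list \<Rightarrow> nat list \<Rightarrow> nat list \<Rightarrow> nat list \<Rightarrow> nat list \<Rightarrow> bool" where
  "locally_kernel M L A B C \<longleftrightarrow>
     list_all (\<lambda>v. (v \<in> set B) \<noteq> list_ex (\<lambda>w. entry M v w) (A @ B @ C)) L"

definition add_step :: "bool \<Rightarrow> bool \<times> bool list \<times> bool list \<Rightarrow> bool \<times> bool list \<times> bool list" where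
  "add_step x s =
     (x \<and> hd_or False (fst (snd s)) \<or> fst s \<and> (x \<or> hd_or False (fst (snd s))),
      tl (fst (snd s)),
      (x \<noteq> (hd_or False (fst (snd s)) \<noteq> fst s)) # snd (snd s))"

text \<open>The width of the first summand is kept and a final carry is dropped. All counters have
  \<open>n + 1\<close> bits, and there are at most \<open>2 ^ n\<close> kernels.\<close>

definition add_bits :: "bool list \<Rightarrow> bool list \<Rightarrow> bool list" where
  "add_bits xs ys = rev (snd (snd (fold add_step xs (False, ys, []))))"

text \<open>The second component is an optional witness, written as a list with at most one member;
  the member lists the vertices of one of the counted sets.\<close>

type_synonym count_witness = "bool list \<times> nat list list"

definition zero_val :: "nat \<Rightarrow> count_witness" where
  "zero_val w = (replicate w False, [])"

definition plus_val :: "count_witness \<Rightarrow> count_witness \<Rightarrow> count_witness" where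
  "plus_val a b = (add_bits (fst a) (fst b), if snd a = [] then snd b else snd a)"

definition sum_vals :: "nat \<Rightarrow> count_witness list \<Rightarrow> count_witness" where
  "sum_vals w vs = fold (\<lambda>v s. plus_val s v) vs (zero_val w)"

text \<open>Filtering \<open>[0..<n]\<close> rather than appending \<open>C\<close> keeps every
  witness a sublist of \<open>[0..<n]\<close>, whose size is bounded however many layers have been
  added.\<close>

definition extend_val :: "nat \<Rightarrow> nat list \<Rightarrow> count_witness \<Rightarrow> count_witness" where
  "extend_val n C a = (fst a, map (\<lambda>K. filter (\<lambda>v. v \<in> set C \<or> v \<in> set K) [0..<n]) (snd a))"

text \<open>The value at \<open>B\<close>, then \<open>A\<close>, describes the partial kernels with trace \<open>B\<close> on the last layer and \<open>A\<close> on
  the one before.\<close>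

type_synonym kernel_table = "(nat list \<times> (nat list \<times> count_witness) list) list"

text \<open>The vertices of \<open>L\<close> can be judged only once the trace \<open>C\<close> on
  the following layer is chosen. After that the trace \<open>A\<close> is no longer relevant, so it
  is summed over, and \<open>B\<close> takes its place as the trace on the layer before.\<close>

definition table_step ::
    "bool list list \<Rightarrow> nat list \<Rightarrow> nat list \<Rightarrow> kernel_table \<Rightarrow> kernel_table" where
  "table_step M L L' T = map (\<lambda>C. (C, map (\<lambda>e. (fst e, extend_val (length M) C
     (sum_vals (Suc (length M))
       (map snd (filter (\<lambda>r. locally_kernel M L (fst r) (fst e) C) (snd e)))))) T)) (small_subsets L')"

text \<open>Before any layer there is exactly one partial kernel, the empty set. The bits are the
  number 1 in width \<open>Suc n\<close>, and the two keys are traces on imaginary empty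
  layers.\<close>

definition initial_table :: "nat \<Rightarrow> kernel_table" where
  "initial_table n = [([], [([], (True # replicate n False, [[]]))])]"

text \<open>The newest layer is processed first, so the empty layer that started the search comes
  last. Adding it forces the check of the layer before it and leaves no vertex unjudged.\<close>

definition final_table :: "bool list list \<Rightarrow> nat list \<times> kernel_table" where
  "final_table M = fold (\<lambda>L' s. (L', table_step M (fst s) L' (snd s))) (layers M)
     ([], initial_table (length M))"

definition total_val :: "bool list list \<Rightarrow> count_witness" where
  "total_val M = sum_vals (Suc (length M)) (map snd (concat (map snd (snd (final_table M)))))"

text \<open>\<open>concat\<close> opens the optional witness: its vertices if there is one, and no
  vertices otherwise.\<close>

definition count_and_find :: "bool list list \<Rightarrow> bool list \<times> bool list" where
  "count_and_find M = (fst (total_val M),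
     map (\<lambda>v. v \<in> set (concat (snd (total_val M)))) [0..<length M])"

section \<open>Running time\<close>

lemma ptime_entry': "ptime (\<lambda>p. entry (fst p) (fst (snd p)) (snd (snd p)))"
  unfolding entry_def by (intro ptime_intros)

lemmas [ptime_intros] = ptime_comp3[where h = entry, OF ptime_entry']

lemma ptime_linked': "ptime (\<lambda>p. linked (fst p) (fst (snd p)) (snd (snd p)))"
  unfolding linked_def by (intro ptime_intros)

lemmas [ptime_intros] = ptime_comp3[where h = linked, OF ptime_linked']

lemma ptime_unvisited': "ptime (\<lambda>p. unvisited (fst p) (snd p))"
  unfolding unvisited_def by (intro ptime_intros)

lemmas [ptime_intros] = ptime_comp2[where h = unvisited, OF ptime_unvisited']

lemma ptime_frontier': "ptime (\<lambda>p. frontier (fst p) (snd p))"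
  unfolding frontier_def by (intro ptime_intros)

lemmas [ptime_intros] = ptime_comp2[where h = frontier, OF ptime_frontier']

lemma ptime_next_layer': "ptime (\<lambda>p. next_layer (fst p) (snd p))"
  unfolding next_layer_def by (intro ptime_intros)

lemmas [ptime_intros] = ptime_comp2[where h = next_layer, OF ptime_next_layer']

lemma esize_next_layer_le: "esize (next_layer M ls) \<le> esize [0..<length M]"
proof -
  have "esize (unvisited (length M) ls) \<le> esize [0..<length M]"
    by (simp add: unvisited_def esize_filter_le)
  then show ?thesis
    unfolding next_layer_def frontier_def
    using esize_take[of 1 "unvisited (length M) ls"] order_trans[OF esize_filter_le] by auto
qed

lemma ptime_layers': "ptime layers"
proof -
  have "ptime (\<lambda>M :: bool list list. [0..<length M])"
    by (intro ptime_intros)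
  then obtain q where q: "\<And>M :: bool list list. esize [0..<length M] \<le> poly q (esize M)"
    using ptime_size_bound[of "\<lambda>M :: bool list list. [0..<length M]"] by blast
  have "ptime (\<lambda>M. fold (\<lambda>_ ls. next_layer M ls # ls) [0..<length M] [[]])"
  proof (rule ptime_fold_additive[where q = "1 + q"])
    fix M :: "bool list list" and a :: nat and ls
    have "esize (next_layer M ls) \<le> poly q (esize M + esize a)"
      using esize_next_layer_le[of M ls] q[of M] poly_nat_mono[of "esize M" "esize M + esize a" q]
      by linarith
    then show "esize (next_layer M ls # ls) \<le> esize ls + poly (1 + q) (esize M + esize a)"
      by simp
  qed (intro ptime_intros)+
  then show ?thesis by (simp add: layers_def[abs_def])
qed

lemmas [ptime_intros] = ptime_comp[where g = layers, OF ptime_layers']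

lemma ptime_grow': "ptime (\<lambda>p. grow (fst p) (snd p))"
  unfolding grow_def by (intro ptime_intros)

lemmas [ptime_intros] = ptime_comp2[where h = grow, OF ptime_grow']

lemma ptime_small_subsets': "ptime small_subsets"
  unfolding small_subsets_def[abs_def] by (intro ptime_intros)

lemmas [ptime_intros] = ptime_comp[where g = small_subsets, OF ptime_small_subsets']

lemma ptime_locally_kernel: "ptime (\<lambda>x. locally_kernel (f x) (g x) (h x) (i x) (j x))"
  if "ptime f" "ptime g" "ptime h" "ptime i" "ptime j"
proof -
  have *: "ptime (\<lambda>(M, L, A, B, C). locally_kernel M L A B C)"
    unfolding case_prod_beta locally_kernel_def by (intro ptime_intros)
  have "ptime (\<lambda>x. (f x, g x, h x, i x, j x))"
    by (intro ptime_intros that)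
  from ptime_comp[OF * this] show ?thesis by simp
qed

lemmas [ptime_intros] = ptime_locally_kernel

lemma ptime_add_step': "ptime (\<lambda>p. add_step (fst p) (snd p))"
  unfolding add_step_def by (intro ptime_intros)

lemmas [ptime_intros] = ptime_comp2[where h = add_step, OF ptime_add_step']

lemma ptime_add_bits': "ptime (\<lambda>p. add_bits (fst p) (snd p))"
proof -
  have "ptime (\<lambda>p. fold (\<lambda>x s. add_step x s) (fst p) (False, snd p, []))"
  proof (rule ptime_fold_additive[where q = "[:5:]"])
    show "esize (add_step x s) \<le> esize s + poly [:5:] (esize y + esize x)" 
      for x s and y :: "bool list \<times> bool list"
    proof -
      have t: "esize (tl ys) \<le> esize ys" for ys :: "bool list"
        by (cases ys) auto
      have b: "esize (b :: bool) \<le> 1" for b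
        by (rule esize_bool_le)
      show ?thesis
        unfolding add_step_def
        using t[of "fst (snd s)"]
          b[of "x \<and> hd_or False (fst (snd s)) \<or> fst s \<and> (x \<or> hd_or False (fst (snd s)))"]
          b[of "x \<noteq> (hd_or False (fst (snd s)) \<noteq> fst s)"]
        by (simp add: esize_prod[of s] esize_prod[of "snd s"] del: encode_eq_Lf_iff)
    qed
  qed (intro ptime_intros)+
  then show ?thesis
    unfolding add_bits_def by (intro ptime_intros) simp
qed

lemmas [ptime_intros] = ptime_comp2[where h = add_bits, OF ptime_add_bits']

lemma ptime_extend_val': "ptime (\<lambda>p. extend_val (fst p) (fst (snd p)) (snd (snd p)))"
  unfolding extend_val_def by (intro ptime_intros)

lemmas [ptime_intros] = ptime_comp3[where h = extend_val, OF ptime_extend_val']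

lemma length_add_bits [simp]: "length (add_bits xs ys) = length xs"
proof -
  have "length (snd (snd (fold add_step xs s))) = length xs + length (snd (snd s))" for s
    by (induction xs arbitrary: s) (auto simp: add_step_def)
  then show ?thesis by (simp add: add_bits_def)
qed

text \<open>For accumulators whose size is controlled only on reachable values, where no additive
  bound holds for arbitrary ones.\<close>

lemma ptime_fold_invariant:
  fixes g :: "'a::encodable \<Rightarrow> 'b::encodable \<Rightarrow> 'c::encodable \<Rightarrow> 'c"
  assumes g: "ptime (\<lambda>p. g (fst p) (fst (snd p)) (snd (snd p)))" and l: "ptime l" and s0: "ptime s0"
    and init: "\<And>x. I x (s0 x)"
    and step: "\<And>x a s. I x s \<Longrightarrow> a \<in> set (l x) \<Longrightarrow> I x (g x a s)"
    and bound: "\<And>x s. I x s \<Longrightarrow> esize s \<le> poly q (esize x)"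
  shows "ptime (\<lambda>x. fold (g x) (l x) (s0 x))"
proof (rule ptime_fold[OF _ l s0])
  show "ptime (\<lambda>(x, a, acc). g x a acc)"
    unfolding case_prod_beta by (rule g)
  fix x k
  have *: "I x (fold (g x) xs s)" if "set xs \<subseteq> set (l x)" "I x s" for xs s
    using that by (induction xs arbitrary: s) (auto simp: step)
  show "esize (fold (g x) (take k (l x)) (s0 x)) \<le> poly q (esize x)"
    by (intro bound * set_take_subset init)
qed

lemma esize_bools_le: "esize (bs :: bool list) \<le> 2 * length bs"
  using esize_le_length[of bs 1, OF esize_bool_le] by simp

lemma snd_sum_vals: "snd (sum_vals w vs) = [] \<or> snd (sum_vals w vs) \<in> snd ` set vs"
proof -
  have "snd (fold (\<lambda>v s. plus_val s v) vs s) \<in> insert (snd s) (snd ` set vs)" for s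
  proof (induction vs arbitrary: s)
    case (Cons v vs)
    have "snd (plus_val s v) \<in> insert (snd s) (snd ` set (v # vs))"
      by (simp add: plus_val_def)
    moreover have "snd (fold (\<lambda>v s. plus_val s v) (v # vs) s) \<in> insert (snd (plus_val s v)) (snd ` set vs)"
      using Cons[of "plus_val s v"] by simp
    ultimately show ?case by (metis insertE insert_iff image_insert list.simps(15))
  qed simp
  from this[of "zero_val w"] show ?thesis
    by (auto simp: sum_vals_def zero_val_def)
qed

lemma length_fst_sum_vals [simp]: "length (fst (sum_vals w vs)) = w"
proof -
  have "length (fst (fold (\<lambda>v s. plus_val s v) vs s)) = length (fst s)" for s
    by (induction vs arbitrary: s) (auto simp: plus_val_def)
  then show ?thesis
    by (simp add: sum_vals_def zero_val_def)
qed

text \<open>Addition may turn zeros into ones, which have larger trees, by an amount depending on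
  the width of the accumulator. The invariant fixes that width and says that the witness, if any, is
  copied from a summand.\<close>

lemma ptime_sum_vals': "ptime (\<lambda>p. sum_vals (fst p) (snd p))"
  unfolding sum_vals_def
proof (rule ptime_fold_invariant[where q = "[:2, 4:]" and
      I = "\<lambda>p s. length (fst s) = fst p \<and> (snd s = [] \<or> snd s \<in> snd ` set (snd p))"])
  fix p :: "nat \<times> count_witness list" and s :: count_witness
  assume s: "length (fst s) = fst p \<and> (snd s = [] \<or> snd s \<in> snd ` set (snd p))"
  have "esize (snd s) \<le> esize (snd p)"
    using s esize_nth[of _ "snd p"] by (fastforce simp: esize_prod)
  then show "esize s \<le> poly [:2, 4:] (esize p)"
    using s esize_bools_le[of "fst s"] by (simp add: esize_prod[of s] esize_prod[of p])
qed (auto simp: zero_val_def plus_val_def intro!: ptime_intros)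

lemmas [ptime_intros] = ptime_comp2[where h = sum_vals, OF ptime_sum_vals']

lemma ptime_table_step': "ptime (\<lambda>(M, L, L', T). table_step M L L' T)"
  unfolding case_prod_beta table_step_def by (intro ptime_intros)

definition val_wf :: "nat \<Rightarrow> count_witness \<Rightarrow> bool" where
  "val_wf n v \<longleftrightarrow> length (fst v) = Suc n \<and> (snd v = [] \<or> (\<exists>K. snd v = [K] \<and> esize K \<le> esize [0..<n]))"

text \<open>A normal form for the tables that occur. It separates their shape, which the two layers
  determine, from the values \<open>f\<close>; size bounds and correctness are both argued about
  \<open>f\<close> alone.\<close>

definition tabulate ::
    "nat list \<Rightarrow> nat list \<Rightarrow> (nat list \<Rightarrow> nat list \<Rightarrow> count_witness) \<Rightarrow> kernel_table" where
  "tabulate L' L f = map (\<lambda>B. (B, map (\<lambda>A. (A, f A B)) (small_subsets L'))) (small_subsets L)"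

lemma small_subsets_Nil [simp]: "small_subsets [] = [[]]"
  by (simp add: small_subsets_def grow_def)

lemma initial_table: "initial_table n = tabulate [] [] (\<lambda>_ _. (True # replicate n False, [[]]))"
  by (simp add: initial_table_def tabulate_def)

lemma table_step_tabulate:
  "table_step M L L' (tabulate Lp L f) = tabulate L L' (\<lambda>B C. extend_val (length M) C
     (sum_vals (Suc (length M)) (map (\<lambda>A. f A B) (filter (\<lambda>A. locally_kernel M L A B C) (small_subsets Lp)))))"
  by (simp add: table_step_def tabulate_def filter_map o_def)

lemma val_wf_extend_sum:
  assumes "\<And>v. v \<in> set vs \<Longrightarrow> val_wf n v"
  shows "val_wf n (extend_val n C (sum_vals (Suc n) vs))"
proof -
  have "\<exists>K. snd (sum_vals (Suc n) vs) = [K]" if "snd (sum_vals (Suc n) vs) \<noteq> []"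
    using that snd_sum_vals[of "Suc n" vs] assms by (fastforce simp: val_wf_def)
  then consider "snd (sum_vals (Suc n) vs) = []" | K where "snd (sum_vals (Suc n) vs) = [K]"
    by blast
  then show ?thesis
    by cases (auto simp: val_wf_def extend_val_def esize_filter_le)
qed

lemma esize_val_wf: "val_wf n v \<Longrightarrow> esize v \<le> 2 * n + esize [0..<n] + 4"
  using esize_bools_le[of "fst v"] by (auto simp: val_wf_def esize_prod[of v])

lemma ptime_final_table': "ptime final_table"
proof -
  obtain pn where pn: "\<And>M :: bool list list. esize [0..<length M] \<le> poly pn (esize M)"
    using ptime_size_bound[of "\<lambda>M :: bool list list. [0..<length M]"] 
      ptime_upt[OF ptime_length[OF ptime_id]] by blast
  obtain pl where pl: "\<And>M. esize (layers M) \<le> poly pl (esize M)"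
    using ptime_size_bound[OF ptime_layers'] by blast
  obtain ps where ps: "\<And>L. esize (small_subsets L) \<le> poly ps (esize L)"
    using ptime_size_bound[OF ptime_small_subsets'] by blast
  define pv where "pv = [:6, 2:] + pn"
  define pss where "pss = ps \<circ>\<^sub>p pl"
  define pt where "pt = 2 + pss * (2 + pss + pv)"
  \<comment> \<open>Both layers indexing the table are bounded by the whole list of layers, so there
    are polynomially many pairs of traces; well-formed values have a size bounded in terms of
    \<open>length M\<close>. The product bounds the table.\<close>
  define I where "I = (\<lambda>M s. esize (fst s) \<le> esize (layers M) \<and> (\<exists>Lp f. esize Lp \<le> esize (layers M) \<and>
    snd s = tabulate Lp (fst s) f \<and> (\<forall>A B. val_wf (length M) (f A B))))"
  have "ptime (\<lambda>M. fold (\<lambda>L' s. (L', table_step M (fst s) L' (snd s))) (layers M)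
     ([], initial_table (length M)))"
  proof (rule ptime_fold_invariant[where I = I and q = "1 + pl + pss * (pss + pt)"])
    have "ptime (\<lambda>p. (fst p, fst (snd (snd p)), fst (snd p), snd (snd (snd p))))"
      by (intro ptime_intros)
    from ptime_comp[OF ptime_table_step' this]
    have "ptime (\<lambda>p. table_step (fst p) (fst (snd (snd p))) (fst (snd p)) (snd (snd (snd p))))"
      by simp
    then show "ptime (\<lambda>p. (fst (snd p),
        table_step (fst p) (fst (snd (snd p))) (fst (snd p)) (snd (snd (snd p)))))"
      by (intro ptime_intros)
    show "ptime (\<lambda>M. ([], initial_table (length M)))"
      unfolding initial_table_def by (intro ptime_intros)
    show "I M ([], initial_table (length M))" for M
      unfolding I_def initial_table
      by (intro conjI exI[of _ "[]"] exI[of _ "\<lambda>_ _. (True # replicate (length M) False, [[]])"])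
        (auto simp: val_wf_def)
    show "I M (L', table_step M (fst s) L' (snd s))" if "I M s" "L' \<in> set (layers M)" for M L' s
    proof -
      from that(1) obtain Lp f where *: "esize (fst s) \<le> esize (layers M)" 
        "snd s = tabulate Lp (fst s) f" "\<And>A B. val_wf (length M) (f A B)"
        unfolding I_def by blast
      have "val_wf (length M) (extend_val (length M) C (sum_vals (Suc (length M))
          (map (\<lambda>A. f A B) (filter (\<lambda>A. locally_kernel M (fst s) A B C) (small_subsets Lp)))))" for B C
        by (rule val_wf_extend_sum) (use * in auto)
      with * esize_nth[OF that(2)] show ?thesis
        unfolding I_def fst_conv snd_conv *(2) table_step_tabulate by blast
    qed
    fix M s
    assume "I M s"
    then obtain Lp f where *: "esize (fst s) \<le> esize (layers M)" "esize Lp \<le> esize (layers M)"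
        "snd s = tabulate Lp (fst s) f" "\<And>A B. val_wf (length M) (f A B)"
      unfolding I_def by blast
    have n: "length M \<le> esize M" by (rule length_le_esize)
    have v: "esize (f A B) \<le> poly pv (esize M)" for A B
      using esize_val_wf[OF *(4)[of A B]] pn[of M] n by (simp add: pv_def)
    have ss: "esize (small_subsets L) \<le> poly pss (esize M)" if "esize L \<le> esize (layers M)" for L
      using ps[of L] pl[of M] that
        poly_nat_mono[of "esize L" "poly pl (esize M)" ps] by (simp add: pss_def poly_pcompose)
    have len: "length (small_subsets L) \<le> poly pss (esize M)" if "esize L \<le> esize (layers M)" for L
      using ss[OF that] length_le_esize[of "small_subsets L"] by linarith
    have mem: "esize A \<le> poly pss (esize M)" if "A \<in> set (small_subsets L)" "esize L \<le> esize (layers M)" for A L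
      using ss[OF that(2)] esize_nth[OF that(1)] by linarith
    have inner: "esize (map (\<lambda>A. (A, f A B)) (small_subsets Lp)) \<le> poly pss (esize M) * (2 + poly pss (esize M) + poly pv (esize M))" for B
    proof -
      have "esize (map (\<lambda>A. (A, f A B)) (small_subsets Lp)) \<le>
          length (map (\<lambda>A. (A, f A B)) (small_subsets Lp)) * Suc (Suc (poly pss (esize M) + poly pv (esize M)))"
      proof (rule esize_le_length)
        fix e
        assume "e \<in> set (map (\<lambda>A. (A, f A B)) (small_subsets Lp))"
        then obtain A where "A \<in> set (small_subsets Lp)" "e = (A, f A B)"
          by auto
        then show "esize e \<le> Suc (poly pss (esize M) + poly pv (esize M))"
          using mem[OF _ *(2), of A] v[of A B] by simp
      qed
      also have "\<dots> \<le> poly pss (esize M) * (2 + poly pss (esize M) + poly pv (esize M))"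
        using len[OF *(2)] by (intro mult_mono) auto
      finally show ?thesis .
    qed
    have "esize (snd s) \<le> length (snd s) * Suc (poly pss (esize M) + (1 + poly pss (esize M) * (2 + poly pss (esize M) + poly pv (esize M))))"
      unfolding *(3) tabulate_def
    proof (rule esize_le_length)
      fix e
      assume "e \<in> set (map (\<lambda>B. (B, map (\<lambda>A. (A, f A B)) (small_subsets Lp))) (small_subsets (fst s)))"
      then obtain B where "B \<in> set (small_subsets (fst s))" "e = (B, map (\<lambda>A. (A, f A B)) (small_subsets Lp))"
        by auto
      then show "esize e \<le> poly pss (esize M) + (1 + poly pss (esize M) * (2 + poly pss (esize M) + poly pv (esize M)))"
        using mem[OF _ *(1), of B] inner[of B] by simp
    qed
    also have "\<dots> \<le> poly pss (esize M) * (poly pss (esize M) + poly pt (esize M))"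
      using len[OF *(1)] unfolding *(3) by (intro mult_mono) (auto simp: tabulate_def pt_def)
    finally show "esize s \<le> poly (1 + pl + pss * (pss + pt)) (esize M)"
      using *(1) pl[of M] by (simp add: esize_prod[of s])
  qed (intro ptime_intros)
  then show ?thesis by (simp add: final_table_def[abs_def])
qed

lemmas [ptime_intros] = ptime_comp[where g = final_table, OF ptime_final_table']

lemma ptime_total_val': "ptime total_val"
  unfolding total_val_def[abs_def] by (intro ptime_intros)

lemmas [ptime_intros] = ptime_comp[where g = total_val, OF ptime_total_val']

lemma ptime_count_and_find: "ptime count_and_find"
  unfolding count_and_find_def[abs_def] by (intro ptime_intros)


section \<open>Correctness of the dynamic program\<close>

abbreviation binval :: "bool list \<Rightarrow> nat" where
  "binval bs \<equiv> horner_sum of_bool 2 bs"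

text \<open>Ripple-carry addition: the outgoing carry \<open>c'\<close> has the weight of the first
  position beyond \<open>xs\<close>, which makes the identity exact. The output is collected in
  reverse.\<close>

lemma fold_add_step:
  assumes "length ys = length xs"
  shows "\<exists>c' r. fold add_step xs (c, ys, out) = (c', [], rev r @ out) \<and> length r = length xs \<and>
    binval r + 2 ^ length xs * of_bool c' = binval xs + binval ys + of_bool c"
  using assms
proof (induction xs arbitrary: c ys out)
  case Nil
  then show ?case by (intro exI[of _ c] exI[of _ "[]"]) simp
next
  case (Cons x xs)
  then obtain y ys' where ys: "ys = y # ys'" "length ys' = length xs"
    by (cases ys) auto
  define c1 where "c1 \<longleftrightarrow> x \<and> y \<or> c \<and> (x \<or> y)"
  define b where "b \<longleftrightarrow> x \<noteq> (y \<noteq> c)"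
  have s: "add_step x (c, ys, out) = (c1, ys', b # out)"
    by (simp add: add_step_def ys c1_def b_def)
  obtain c' r where IH: "fold add_step xs (c1, ys', b # out) = (c', [], rev r @ b # out)"
    "length r = length xs" "binval r + 2 ^ length xs * of_bool c' = binval xs + binval ys' + of_bool c1"
    using Cons.IH[OF ys(2), of c1 "b # out"] by blast
  have d: "of_bool b + 2 * of_bool c1 = of_bool x + of_bool y + (of_bool c :: nat)"
    by (cases x; cases y; cases c) (auto simp: b_def c1_def)
  have "binval (b # r) + 2 ^ length (x # xs) * of_bool c' =
      of_bool b + 2 * (binval r + 2 ^ length xs * of_bool c')"
    by simp
  also have "\<dots> = binval (x # xs) + binval ys + of_bool c"
    unfolding IH(3) using d by (simp add: ys)
  finally show ?case
    using s IH by (intro exI[of _ c'] exI[of _ "b # r"]) simp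
qed

lemma binval_add_bits:
  assumes "length ys = length xs"
  shows "binval (add_bits xs ys) = (binval xs + binval ys) mod 2 ^ length xs"
proof -
  obtain c r where r: "fold add_step xs (False, ys, []) = (c, [], rev r @ [])" "length r = length xs"
    "binval r + 2 ^ length xs * of_bool c = binval xs + binval ys + of_bool False"
    using fold_add_step[OF assms, of False "[]"] by blast
  have "add_bits xs ys = r"
    using r(1) by (simp add: add_bits_def)
  moreover have "binval r < 2 ^ length xs"
    using horner_sum_of_bool_2_less[of r] r(2) by simp
  ultimately show ?thesis
    using r(3) by (metis add.right_neutral mod_less mod_mult_self2 of_bool_eq(1))
qed

text \<open>The count is required only modulo \<open>2 ^ w\<close>, so that addition needs no
  overflow condition; a bound on the final family removes the modulus once, at the end.\<close>

definition represents :: "count_witness \<Rightarrow> nat \<Rightarrow> nat set set \<Rightarrow> bool" where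
  "represents v w \<K> \<longleftrightarrow> finite \<K> \<and> length (fst v) = w \<and> binval (fst v) = card \<K> mod 2 ^ w \<and>
     (if \<K> = {} then snd v = [] else \<exists>K. snd v = [K] \<and> set K \<in> \<K>)"

lemma binval_replicate_False [simp]: "binval (replicate n False) = 0"
  by (induction n) auto

lemma represents_zero_val: "represents (zero_val w) w {}"
  by (simp add: represents_def zero_val_def)

lemma represents_plus_val:
  assumes "represents a w \<K>" "represents b w \<L>" "\<K> \<inter> \<L> = {}"
  shows "represents (plus_val a b) w (\<K> \<union> \<L>)"
proof -
  have "card (\<K> \<union> \<L>) = card \<K> + card \<L>"
    using assms by (intro card_Un_disjoint) (auto simp: represents_def)
  then show ?thesis
    using assms by (auto simp: represents_def plus_val_def binval_add_bits mod_add_eq split: if_splits)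
qed

lemma represents_sum_vals:
  assumes "distinct As" "\<And>A. A \<in> set As \<Longrightarrow> represents (g A) w (F A)"
    and "\<And>A A'. A \<in> set As \<Longrightarrow> A' \<in> set As \<Longrightarrow> A \<noteq> A' \<Longrightarrow> F A \<inter> F A' = {}"
  shows "represents (sum_vals w (map g As)) w (\<Union>A\<in>set As. F A)"
proof -
  have "represents (fold (\<lambda>v s. plus_val s v) (map g As) s) w (X \<union> (\<Union>A\<in>set As. F A))"
    if "represents s w X" "X \<inter> (\<Union>A\<in>set As. F A) = {}" for s X
    using assms that
  proof (induction As arbitrary: s X)
    case (Cons A As)
    have "represents (plus_val s (g A)) w (X \<union> F A)"
      using Cons.prems by (intro represents_plus_val) auto
    moreover have "(X \<union> F A) \<inter> (\<Union>A\<in>set As. F A) = {}"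
    proof -
      have "F A \<inter> F A' = {}" if "A' \<in> set As" for A'
        using Cons.prems(1) Cons.prems(3)[of A A'] that by auto
      then show ?thesis using Cons.prems(5) by auto
    qed
    ultimately have "represents (fold (\<lambda>v s. plus_val s v) (map g As) (plus_val s (g A))) w
        ((X \<union> F A) \<union> (\<Union>A\<in>set As. F A))"
      using Cons.prems by (intro Cons.IH) auto
    then show ?case by (simp add: Un_assoc)
  qed simp
  from this[OF represents_zero_val] show ?thesis
    by (simp add: sum_vals_def)
qed

lemma represents_extend_val:
  assumes "represents v w \<K>" "\<And>K. K \<in> \<K> \<Longrightarrow> K \<subseteq> {..<n}" "set C \<subseteq> {..<n}"
    and "inj_on (\<lambda>K. set C \<union> K) \<K>"
  shows "represents (extend_val n C v) w ((\<lambda>K. set C \<union> K) ` \<K>)"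
proof (cases "\<K> = {}")
  case True
  then show ?thesis using assms(1) by (simp add: represents_def extend_val_def)
next
  case False
  then obtain K where K: "snd v = [K]" "set K \<in> \<K>"
    using assms(1) by (auto simp: represents_def)
  have "set (filter (\<lambda>v. v \<in> set C \<or> v \<in> set K) [0..<n]) = set C \<union> set K"
    using assms(2)[OF K(2)] assms(3) by auto
  then show ?thesis
    using False assms(1,4) K by (auto simp: represents_def extend_val_def card_image)
qed

lemma represents_initial: "represents (True # replicate n False, [[]]) (Suc n) {{}}"
  by (simp add: represents_def)

section \<open>Enumeration of small sets\<close>

lemma set_grow: "set (grow L X) = insert [] {v # A | v A. v \<in> set L \<and> A \<in> set X \<and> (\<forall>u\<in>set A. v < u)}"
  by (auto simp: grow_def list_all_iff)

lemma set_grow_sorted: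
  assumes "set X = {xs. sorted_wrt (<) xs \<and> set xs \<subseteq> set L \<and> length xs \<le> k}"
  shows "set (grow L X) = {xs. sorted_wrt (<) xs \<and> set xs \<subseteq> set L \<and> length xs \<le> Suc k}" (is "_ = ?R")
proof
  show "?R \<subseteq> set (grow L X)"
  proof
    fix xs
    assume "xs \<in> ?R"
    then show "xs \<in> set (grow L X)"
      using assms by (cases xs) (auto simp: set_grow)
  qed
qed (use assms in \<open>auto simp: set_grow\<close>)

lemma distinct_grow:
  assumes "distinct L" "distinct X"
  shows "distinct (grow L X)"
proof -
  have "distinct (concat (map (\<lambda>v. map (\<lambda>A. v # A) (filter (\<lambda>A. list_all (\<lambda>u. v < u) A) X)) L))"
    using assms by (induction L) (auto simp: distinct_map)
  then show ?thesis by (auto simp: grow_def)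
qed

lemma set_small_subsets:
  "set (small_subsets L) = {xs. sorted_wrt (<) xs \<and> set xs \<subseteq> set L \<and> length xs \<le> 4}"
proof -
  have "set [[]] = {xs. sorted_wrt (<) xs \<and> set xs \<subseteq> set L \<and> length xs \<le> 0}"
    by auto
  from set_grow_sorted[OF set_grow_sorted[OF set_grow_sorted[OF set_grow_sorted[OF this]]]]
  show ?thesis by (simp add: small_subsets_def eval_nat_numeral)
qed

lemma distinct_small_subsets: "distinct L \<Longrightarrow> distinct (small_subsets L)"
  by (simp add: small_subsets_def distinct_grow)

text \<open>A strictly increasing list is determined by its set. Different listed traces therefore
  belong to disjoint families of partial kernels, and their counts may be added.\<close>

lemma small_subsets_set_eqD:
  "A \<in> set (small_subsets L) \<Longrightarrow> A' \<in> set (small_subsets L') \<Longrightarrow> set A = set A' \<Longrightarrow> A = A'"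
  by (auto simp: set_small_subsets intro: strict_sorted_equal)

lemma small_subsetsE:
  assumes "X \<subseteq> set L" "card X \<le> 4"
  obtains A where "A \<in> set (small_subsets L)" "set A = X"
proof
  have "finite X" using assms(1) finite_subset by blast
  then show "sorted_list_of_set X \<in> set (small_subsets L)" "set (sorted_list_of_set X) = X"
    using assms by (auto simp: set_small_subsets)
qed

text \<open>\<open>L\<close> is the last and \<open>Lp\<close> the last but one of the layers making up \<open>U\<close>. Vertices of \<open>L\<close> may still
  have out-neighbours outside \<open>U\<close>, so nothing is required of them yet.\<close>

definition partial_kernels :: "bool list list \<Rightarrow> nat set \<Rightarrow> nat list \<Rightarrow> nat list \<Rightarrow>
    nat list \<Rightarrow> nat list \<Rightarrow> nat set set" where
  "partial_kernels M U Lp L A B = {K. K \<subseteq> U \<and> K \<inter> set Lp = set A \<and> K \<inter> set L = set B \<and>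
     (\<forall>v\<in>U - set L. (v \<in> K) \<noteq> (\<exists>w\<in>K. entry M v w))}"

text \<open>By \<open>sep\<close>, the new layer does not affect vertices judged earlier; by
  \<open>sep'\<close>, the verdict on a vertex of \<open>L\<close> depends on the three traces only.
  So a set on the left is the same as its part in \<open>U\<close>, a partial kernel for some trace
  \<open>A\<close>, together with \<open>C\<close>.\<close>

lemma partial_kernels_step:
  assumes sub: "set Lp \<subseteq> U - set L" "set L \<subseteq> U" "U \<inter> set L' = {}"
    and sep: "\<And>v w. v \<in> U - set L \<Longrightarrow> w \<in> set L' \<Longrightarrow> \<not> entry M v w"
    and sep': "\<And>v w. v \<in> set L \<Longrightarrow> w \<in> U \<Longrightarrow> entry M v w \<Longrightarrow> w \<in> set Lp \<union> set L"
    and ind: "\<And>X. X \<subseteq> set Lp \<Longrightarrow> (\<And>u w. u \<in> X \<Longrightarrow> w \<in> X \<Longrightarrow> \<not> entry M u w) \<Longrightarrow> card X \<le> 4"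
    and B: "set B \<subseteq> set L" and C: "set C \<subseteq> set L'"
  shows "partial_kernels M (U \<union> set L') L L' B C = (\<lambda>K. set C \<union> K) `
    (\<Union>A\<in>set (filter (\<lambda>A. locally_kernel M L A B C) (small_subsets Lp)). partial_kernels M U Lp L A B)"
proof (intro equalityI subsetI)
  fix K'
  assume "K' \<in> partial_kernels M (U \<union> set L') L L' B C"
  then have K': "K' \<subseteq> U \<union> set L'" "K' \<inter> set L = set B" "K' \<inter> set L' = set C"
      "\<And>v. v \<in> U \<Longrightarrow> (v \<in> K') \<noteq> (\<exists>w\<in>K'. entry M v w)"
    using sub(3) by (auto simp: partial_kernels_def)
  define K where "K = K' \<inter> U"
  \<comment> \<open>The vertices of \<open>Lp\<close> are already judged, so the kernel condition
    makes this trace independent; hence it is among the enumerated ones.\<close>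
  have "card (K' \<inter> set Lp) \<le> 4"
  proof (rule ind)
    show "\<not> entry M u w" if "u \<in> K' \<inter> set Lp" "w \<in> K' \<inter> set Lp" for u w
      using K'(4)[of u] that sub(1) by blast
  qed auto
  then obtain A where A: "A \<in> set (small_subsets Lp)" "set A = K' \<inter> set Lp"
    using small_subsetsE[of "K' \<inter> set Lp" Lp] by blast
  have "(v \<in> K) \<noteq> (\<exists>w\<in>K. entry M v w)" if "v \<in> U - set L" for v
    using K'(4)[of v] that sep[of v] K'(1) unfolding K_def by blast
  then have "K \<in> partial_kernels M U Lp L A B"
    using sub A(2) K'(2) by (auto simp: partial_kernels_def K_def)
  moreover have "locally_kernel M L A B C"
    unfolding locally_kernel_def list_all_iff list_ex_iff
  proof
    fix v
    assume v: "v \<in> set L"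
    have "(\<exists>w\<in>set (A @ B @ C). entry M v w) \<longleftrightarrow> (\<exists>w\<in>K'. entry M v w)"
      using sep'[OF v] K'(1-3) A(2) by auto blast+
    moreover have "v \<in> set B \<longleftrightarrow> v \<in> K'" using K'(2) v by blast
    ultimately show "(v \<in> set B) \<noteq> (\<exists>w\<in>set (A @ B @ C). entry M v w)"
      using K'(4)[of v] v sub(2) by blast
  qed
  moreover have "K' = set C \<union> K" using K'(1,3) by (auto simp: K_def)
  ultimately show "K' \<in> (\<lambda>K. set C \<union> K) `
    (\<Union>A\<in>set (filter (\<lambda>A. locally_kernel M L A B C) (small_subsets Lp)). partial_kernels M U Lp L A B)"
    using A(1) by auto
next
  fix K'
  assume "K' \<in> (\<lambda>K. set C \<union> K) `
    (\<Union>A\<in>set (filter (\<lambda>A. locally_kernel M L A B C) (small_subsets Lp)). partial_kernels M U Lp L A B)"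
  then obtain A K where A: "A \<in> set (small_subsets Lp)" "locally_kernel M L A B C"
    and K: "K \<in> partial_kernels M U Lp L A B" and K': "K' = set C \<union> K"
    by auto
  have K1: "K \<subseteq> U" "K \<inter> set Lp = set A" "K \<inter> set L = set B"
    "\<And>v. v \<in> U - set L \<Longrightarrow> (v \<in> K) \<noteq> (\<exists>w\<in>K. entry M v w)"
    using K by (auto simp: partial_kernels_def)
  have "(v \<in> K') \<noteq> (\<exists>w\<in>K'. entry M v w)" if v: "v \<in> U" for v
  proof (cases "v \<in> set L")
    case True
    have "(\<exists>w\<in>set (A @ B @ C). entry M v w) \<longleftrightarrow> (\<exists>w\<in>K'. entry M v w)"
      using sep'[OF True] K1(1-3) K' by auto blast+
    moreover have "v \<in> set B \<longleftrightarrow> v \<in> K'" using K1(3) K' C sub True by blast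
    ultimately show ?thesis
      using A(2) True unfolding locally_kernel_def list_all_iff list_ex_iff by blast
  next
    case False
    then show ?thesis
      using K1(4)[of v] v sep[of v] K' C sub(3) by blast
  qed
  then show "K' \<in> partial_kernels M (U \<union> set L') L L' B C"
    using K1 K' B C sub by (auto simp: partial_kernels_def)
qed

lemma partial_kernels_inj:
  assumes "U \<inter> set L' = {}" "set C \<subseteq> set L'" "\<And>K. K \<in> \<K> \<Longrightarrow> K \<subseteq> U"
  shows "inj_on (\<lambda>K. set C \<union> K) \<K>"
  using assms by (intro inj_onI) blast

section \<open>Correctness of the tables along a layering\<close>

definition layering :: "bool list list \<Rightarrow> nat list list \<Rightarrow> bool" where
  "layering M ls \<longleftrightarrow> distinct (concat ls) \<and> set (concat ls) \<subseteq> {..<length M} \<and>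
     (\<forall>i j u w. i < j \<longrightarrow> j < length ls \<longrightarrow> u \<in> set (ls ! i) \<longrightarrow> w \<in> set (ls ! j) \<longrightarrow>
       linked M u w \<longrightarrow> j = Suc i)"

definition small_independence :: "bool list list \<Rightarrow> nat list \<Rightarrow> bool" where
  "small_independence M L \<longleftrightarrow> (\<forall>X\<subseteq>set L. (\<forall>u\<in>X. \<forall>w\<in>X. \<not> entry M u w) \<longrightarrow> card X \<le> 4)"

lemma small_independenceD:
  "small_independence M L \<Longrightarrow> X \<subseteq> set L \<Longrightarrow> (\<And>u w. u \<in> X \<Longrightarrow> w \<in> X \<Longrightarrow> \<not> entry M u w) \<Longrightarrow>
    card X \<le> 4"
  by (simp add: small_independence_def)

lemma layering_append: "layering M (xs @ ys) \<Longrightarrow> layering M xs"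
  unfolding layering_def by (auto simp: nth_append)

text \<open>The default \<open>[]\<close> stands for the imaginary empty layers before the first
  one, in agreement with \<open>initial_table\<close>.\<close>

definition last_layer :: "nat list list \<Rightarrow> nat list" where
  "last_layer xs = hd_or [] (rev xs)"

definition penultimate_layer :: "nat list list \<Rightarrow> nat list" where
  "penultimate_layer xs = hd_or [] (tl (rev xs))"

lemma last_layer_snoc [simp]: "last_layer (xs @ [L]) = L"
  and penultimate_layer_snoc [simp]: "penultimate_layer (xs @ [L]) = last_layer xs"
  by (simp_all add: last_layer_def penultimate_layer_def)

lemma fold_table_step:
  assumes "layering M ls" "\<And>L. L \<in> set ls \<Longrightarrow> small_independence M L"
  shows "\<exists>f. fold (\<lambda>L' s. (L', table_step M (fst s) L' (snd s))) ls ([], initial_table (length M)) =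
      (last_layer ls, tabulate (penultimate_layer ls) (last_layer ls) f) \<and>
    (\<forall>A\<in>set (small_subsets (penultimate_layer ls)). \<forall>B\<in>set (small_subsets (last_layer ls)).
      represents (f A B) (Suc (length M))
        (partial_kernels M (set (concat ls)) (penultimate_layer ls) (last_layer ls) A B))"
  using assms
proof (induction ls rule: rev_induct)
  case Nil
  have "partial_kernels M {} [] [] [] [] = {{}}"
    by (auto simp: partial_kernels_def)
  then show ?case
    by (intro exI[of _ "\<lambda>_ _. (True # replicate (length M) False, [[]])"])
      (simp add: initial_table last_layer_def penultimate_layer_def represents_initial)
next
  case (snoc L' xs)
  let ?n = "length M" and ?L = "last_layer xs" and ?Lp = "penultimate_layer xs" and ?U = "set (concat xs)"
  obtain f where f: "fold (\<lambda>L' s. (L', table_step M (fst s) L' (snd s))) xs ([], initial_table ?n) =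
      (?L, tabulate ?Lp ?L f)"
    "\<And>A B. A \<in> set (small_subsets ?Lp) \<Longrightarrow> B \<in> set (small_subsets ?L) \<Longrightarrow>
      represents (f A B) (Suc ?n) (partial_kernels M ?U ?Lp ?L A B)"
    using snoc.IH[OF layering_append[OF snoc.prems(1)]] snoc.prems(2) by auto
  have dist: "distinct (concat xs @ L')" and bound: "?U \<subseteq> {..<?n}" "set L' \<subseteq> {..<?n}"
    using snoc.prems(1) by (auto simp: layering_def)
  have far: "j = Suc i" if "i < j" "j < length (xs @ [L'])" "u \<in> set ((xs @ [L']) ! i)"
      "w \<in> set ((xs @ [L']) ! j)" "linked M u w" for i j u w
    using snoc.prems(1) that unfolding layering_def by blast
  \<comment> \<open>Three shapes suffice, since a step looks back at most two layers.\<close>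
  have shape: "xs = [] \<or> (\<exists>L. xs = [L]) \<or> (\<exists>ys Lp L. xs = ys @ [Lp, L])"
    by (metis append.assoc append_Cons append_Nil rev_exhaust)
  have LpL: "set ?Lp \<subseteq> ?U - set ?L" "set ?L \<subseteq> ?U" "distinct ?Lp"
    "(\<And>X. X \<subseteq> set ?Lp \<Longrightarrow> (\<And>u w. u \<in> X \<Longrightarrow> w \<in> X \<Longrightarrow> \<not> entry M u w) \<Longrightarrow> card X \<le> 4)"
  proof -
    have "set ?Lp \<subseteq> ?U - set ?L \<and> set ?L \<subseteq> ?U \<and> distinct ?Lp \<and> (?Lp = [] \<or> ?Lp \<in> set xs)"
      using shape dist by (elim disjE exE) (auto simp: last_layer_def penultimate_layer_def)
    moreover have "small_independence M []"
      by (simp add: small_independence_def)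
    ultimately have "small_independence M ?Lp" and *: "set ?Lp \<subseteq> ?U - set ?L" "set ?L \<subseteq> ?U" "distinct ?Lp"
      using snoc.prems(2) by auto
    then show "set ?Lp \<subseteq> ?U - set ?L" "set ?L \<subseteq> ?U" "distinct ?Lp"
      "(\<And>X. X \<subseteq> set ?Lp \<Longrightarrow> (\<And>u w. u \<in> X \<Longrightarrow> w \<in> X \<Longrightarrow> \<not> entry M u w) \<Longrightarrow> card X \<le> 4)"
      using small_independenceD by blast+
  qed
  have U: "\<exists>i<length xs. v \<in> set (xs ! i)" if "v \<in> ?U" for v
    using that unfolding set_concat by (metis UN_E in_set_conv_nth)
  have Lnth: "?L = xs ! (length xs - 1)" if "xs \<noteq> []"
    using that by (cases xs rule: rev_cases) auto
  have Lpnth: "?Lp = xs ! (length xs - 2)" if "2 \<le> length xs"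
    using shape that
    by (elim disjE exE) (auto simp: last_layer_def penultimate_layer_def nth_append)
  have sep: "\<not> entry M v w" if "v \<in> ?U - set ?L" "w \<in> set L'" for v w
  proof
    assume "entry M v w"
    obtain i where i: "i < length xs" "v \<in> set (xs ! i)" using U \<open>v \<in> ?U - set ?L\<close> by blast
    then have "length xs = Suc i"
      using far[of i "length xs" v w] that(2) \<open>entry M v w\<close> by (auto simp: nth_append linked_def)
    then have "?L = xs ! i" using Lnth by (cases xs) auto
    with i that(1) show False by simp
  qed
  have sep': "w \<in> set ?Lp \<union> set ?L" if "v \<in> set ?L" "w \<in> ?U" "entry M v w" for v w
  proof -
    have "xs \<noteq> []" using that(1) by (auto simp: last_layer_def)
    obtain i where i: "i < length xs" "w \<in> set (xs ! i)" using U \<open>w \<in> ?U\<close> by blast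
    show ?thesis
    proof (cases "i = length xs - 1")
      case True
      then show ?thesis using i Lnth[OF \<open>xs \<noteq> []\<close>] by simp
    next
      case False
      then have "i < length xs - 1" "length xs - 1 < length xs" using i(1) by auto
      then have "length xs - 1 = Suc i"
        using far[of i "length xs - 1" w v] that(1,3) i Lnth[OF \<open>xs \<noteq> []\<close>]
        by (simp add: nth_append linked_def)
      then have "i = length xs - 2" "2 \<le> length xs" by auto
      then show ?thesis using i Lpnth by simp
    qed
  qed
  have UL': "?U \<inter> set L' = {}" using dist by auto
  define f' where "f' = (\<lambda>B C. extend_val ?n C (sum_vals (Suc ?n)
    (map (\<lambda>A. f A B) (filter (\<lambda>A. locally_kernel M ?L A B C) (small_subsets ?Lp)))))"
  have "represents (f' B C) (Suc ?n) (partial_kernels M (?U \<union> set L') ?L L' B C)"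
    if B: "B \<in> set (small_subsets ?L)" and C: "C \<in> set (small_subsets L')" for B C
  proof -
    let ?As = "filter (\<lambda>A. locally_kernel M ?L A B C) (small_subsets ?Lp)"
    have BC: "set B \<subseteq> set ?L" "set C \<subseteq> set L'"
      using B C by (auto simp: set_small_subsets)
    have r: "represents (sum_vals (Suc ?n) (map (\<lambda>A. f A B) ?As)) (Suc ?n)
        (\<Union>A\<in>set ?As. partial_kernels M ?U ?Lp ?L A B)"
    proof (rule represents_sum_vals)
      show "distinct ?As" using LpL(3) by (simp add: distinct_small_subsets)
      show "represents (f A B) (Suc ?n) (partial_kernels M ?U ?Lp ?L A B)" if "A \<in> set ?As" for A
        using f(2)[of A B] B that by simp
      show "partial_kernels M ?U ?Lp ?L A B \<inter> partial_kernels M ?U ?Lp ?L A' B = {}"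
        if "A \<in> set ?As" "A' \<in> set ?As" "A \<noteq> A'" for A A'
        using small_subsets_set_eqD[of A ?Lp A' ?Lp] that by (auto simp: partial_kernels_def)
    qed
    have eq: "partial_kernels M (?U \<union> set L') ?L L' B C =
        (\<lambda>K. set C \<union> K) ` (\<Union>A\<in>set ?As. partial_kernels M ?U ?Lp ?L A B)"
      by (rule partial_kernels_step[OF LpL(1,2) UL' _ _ _ BC]) (use sep sep' LpL(4) in blast)+
    show ?thesis
      unfolding eq f'_def
    proof (rule represents_extend_val[OF r])
      show K: "K \<subseteq> {..<?n}" if "K \<in> (\<Union>A\<in>set ?As. partial_kernels M ?U ?Lp ?L A B)" for K
      proof -
        have "K \<subseteq> ?U" using that by (auto simp: partial_kernels_def)
        then show ?thesis using bound(1) by (rule order_trans)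
      qed
      show "set C \<subseteq> {..<?n}" using BC bound by blast
      show "inj_on (\<lambda>K. set C \<union> K) (\<Union>A\<in>set ?As. partial_kernels M ?U ?Lp ?L A B)"
        by (rule partial_kernels_inj[OF UL' BC(2)]) (auto simp: partial_kernels_def)
    qed
  qed
  moreover have "fold (\<lambda>L' s. (L', table_step M (fst s) L' (snd s))) (xs @ [L']) ([], initial_table ?n) =
      (L', tabulate ?L L' f')"
    by (simp add: f(1) table_step_tabulate f'_def)
  ultimately show ?case by (intro exI[of _ f']) simp
qed

definition kernel_sets :: "bool list list \<Rightarrow> nat set set" where
  "kernel_sets M = {K. K \<subseteq> {..<length M} \<and> (\<forall>v<length M. (v \<in> K) \<noteq> (\<exists>w\<in>K. entry M v w))}"

text \<open>With the empty layer last, \<open>U - set L\<close> is the set of all vertices. The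
  remaining partial kernels are thus judged everywhere, and summing over their traces on the layer
  before gives all kernels, each once.\<close>

lemma represents_total_val:
  assumes "layering M (layers M)" "\<And>L. L \<in> set (layers M) \<Longrightarrow> small_independence M L"
    and last: "layers M = xs @ [[]]" and all: "set (concat (layers M)) = {..<length M}"
  shows "represents (total_val M) (Suc (length M)) (kernel_sets M)"
proof -
  let ?L = "last_layer xs" and ?n = "length M"
  obtain f where f: "final_table M = ([], tabulate ?L [] f)"
    "\<And>A. A \<in> set (small_subsets ?L) \<Longrightarrow>
      represents (f A []) (Suc ?n) (partial_kernels M {..<?n} ?L [] A [])"
    using fold_table_step[OF assms(1,2)] unfolding final_table_def all by (auto simp: last)
  have total: "total_val M = sum_vals (Suc ?n) (map (\<lambda>A. f A []) (small_subsets ?L))"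
    by (simp add: total_val_def f(1) tabulate_def o_def)
  have L: "distinct ?L" "set ?L \<subseteq> {..<?n}" "small_independence M ?L"
  proof -
    have "?L = [] \<or> ?L \<in> set (layers M)"
      unfolding last by (cases xs rule: rev_cases) (auto simp: last_layer_def)
    then show "distinct ?L" "set ?L \<subseteq> {..<?n}" "small_independence M ?L"
      using assms(1,2) all by (auto simp: layering_def distinct_concat_iff small_independence_def)
  qed
  have "kernel_sets M = (\<Union>A\<in>set (small_subsets ?L). partial_kernels M {..<?n} ?L [] A [])"
  proof (intro equalityI subsetI)
    fix K
    assume K: "K \<in> kernel_sets M"
    have "card (K \<inter> set ?L) \<le> 4"
    proof (rule small_independenceD[OF L(3)])
      show "\<not> entry M u w" if "u \<in> K \<inter> set ?L" "w \<in> K \<inter> set ?L" for u w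
        using K L(2) that unfolding kernel_sets_def by blast
    qed auto
    then obtain A where "A \<in> set (small_subsets ?L)" "set A = K \<inter> set ?L"
      using small_subsetsE[of "K \<inter> set ?L" ?L] by blast
    with K show "K \<in> (\<Union>A\<in>set (small_subsets ?L). partial_kernels M {..<?n} ?L [] A [])"
      by (auto simp: kernel_sets_def partial_kernels_def)
  qed (auto simp: kernel_sets_def partial_kernels_def)
  moreover have "represents (sum_vals (Suc ?n) (map (\<lambda>A. f A []) (small_subsets ?L))) (Suc ?n)
      (\<Union>A\<in>set (small_subsets ?L). partial_kernels M {..<?n} ?L [] A [])"
  proof (rule represents_sum_vals)
    show "distinct (small_subsets ?L)" using L(1) by (rule distinct_small_subsets)
    show "partial_kernels M {..<?n} ?L [] A [] \<inter> partial_kernels M {..<?n} ?L [] A' [] = {}"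
      if "A \<in> set (small_subsets ?L)" "A' \<in> set (small_subsets ?L)" "A \<noteq> A'" for A A'
      using small_subsets_set_eqD[of A ?L A' ?L] that by (auto simp: partial_kernels_def)
  qed (rule f(2))
  ultimately show ?thesis by (simp add: total)
qed

lemma count_and_find_correct:
  assumes "layering M (layers M)" "\<And>L. L \<in> set (layers M) \<Longrightarrow> small_independence M L"
    and last: "layers M = xs @ [[]]" and all: "set (concat (layers M)) = {..<length M}"
  shows "binval (fst (count_and_find M)) = card (kernel_sets M)"
    and "kernel_sets M \<noteq> {} \<Longrightarrow>
      \<exists>K\<in>kernel_sets M. snd (count_and_find M) = map (\<lambda>v. v \<in> K) [0..<length M]"
proof -
  have r: "represents (total_val M) (Suc (length M)) (kernel_sets M)"
    by (rule represents_total_val[OF assms])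
  \<comment> \<open>At most \<open>2 ^ n\<close> sets are counted with \<open>n + 1\<close> bits, so
    the count modulo \<open>2 ^ Suc n\<close> is the count itself.\<close>
  have "card (kernel_sets M) \<le> card (Pow {..<length M})"
    by (intro card_mono) (auto simp: kernel_sets_def)
  also have "\<dots> < 2 ^ Suc (length M)" by (simp add: card_Pow)
  finally show "binval (fst (count_and_find M)) = card (kernel_sets M)"
    using r by (simp add: represents_def count_and_find_def)
  show "\<exists>K\<in>kernel_sets M. snd (count_and_find M) = map (\<lambda>v. v \<in> K) [0..<length M]"
    if "kernel_sets M \<noteq> {}"
    using r that by (auto simp: represents_def count_and_find_def)
qed

section \<open>Breadth-first layers\<close>

text \<open>The newest layer is the head, so \<open>Suc i\<close> is the layer found just before
  layer \<open>i\<close>, and only the head may still have unvisited neighbours. The alternative of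
  length at most one covers new roots and empty layers.\<close>

definition layering_stage :: "bool list list \<Rightarrow> nat list list \<Rightarrow> bool" where
  "layering_stage M ls \<longleftrightarrow> layering M ls \<and>
     (\<forall>u\<in>set (concat (tl ls)). \<forall>w\<in>set (unvisited (length M) ls). \<not> linked M u w) \<and>
     (\<forall>i<length ls. length (ls ! i) \<le> 1 \<or>
       (Suc i < length ls \<and> (\<forall>v\<in>set (ls ! i). \<exists>u\<in>set (ls ! Suc i). linked M u v)))"

lemma linked_sym: "linked M u v \<longleftrightarrow> linked M v u"
  by (auto simp: linked_def)

text \<open>All unvisited neighbours of the head enter the new layer, so afterwards only the new
  layer can be linked to unvisited vertices. If there are none, the new layer has at most one
  vertex.\<close>

lemma layering_stage_Cons:
  assumes "layering_stage M ls" "ls \<noteq> []"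
  shows "layering_stage M (next_layer M ls # ls)"
proof -
  let ?F = "next_layer M ls"
  obtain L ls' where ls: "ls = L # ls'" using assms(2) by (cases ls) auto
  have F: "set ?F \<subseteq> set (unvisited (length M) ls)" "distinct ?F"
    using set_take_subset[of 1 "unvisited (length M) ls"]
    by (auto simp: next_layer_def frontier_def unvisited_def)
  have unv: "set (unvisited (length M) ls) = {..<length M} - set (concat ls)"
    by (auto simp: unvisited_def)
  have fr: "w \<in> set ?F" if "u \<in> set L" "w \<in> set (unvisited (length M) ls)" "linked M u w" for u w
  proof -
    have "w \<in> set (frontier M ls)" using that by (auto simp: frontier_def ls list_ex_iff)
    then show ?thesis by (auto simp: next_layer_def)
  qed
  have old: "\<not> linked M u w" if "u \<in> set (concat ls')" "w \<in> set (unvisited (length M) ls)" for u w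
    using assms(1) that by (auto simp: layering_stage_def ls)
  have lay: "layering M ls" using assms(1) by (simp add: layering_stage_def)
  have "layering M (?F # ls)"
    unfolding layering_def
  proof (intro conjI allI impI)
    show "distinct (concat (?F # ls))" "set (concat (?F # ls)) \<subseteq> {..<length M}"
      using lay F unv by (auto simp: layering_def)
    fix i j u w
    assume *: "i < j" "j < length (?F # ls)" "u \<in> set ((?F # ls) ! i)" "w \<in> set ((?F # ls) ! j)" "linked M u w"
    show "j = Suc i"
    proof (cases i)
      case 0
      show ?thesis
      proof (rule ccontr)
        assume "j \<noteq> Suc i"
        then obtain k where "j = Suc (Suc k)" using * 0 by (metis Suc_lessE less_SucE not0_implies_Suc less_nat_zero_code)
        then have "w \<in> set (concat ls')" using * by (auto simp: ls)
        then show False using old[of w u] * 0 F(1) linked_sym by auto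
      qed
    next
      case (Suc i')
      then obtain j' where "j = Suc j'" using * by (cases j) auto
      then show ?thesis using lay * Suc unfolding layering_def by auto
    qed
  qed
  moreover have "\<not> linked M u w" if "u \<in> set (concat ls)" "w \<in> set (unvisited (length M) (?F # ls))" for u w
    using that fr[of u w] old[of u w] by (auto simp: ls unvisited_def)
  moreover have "length ((?F # ls) ! i) \<le> 1 \<or> (Suc i < length (?F # ls) \<and>
      (\<forall>v\<in>set ((?F # ls) ! i). \<exists>u\<in>set ((?F # ls) ! Suc i). linked M u v))" if "i < length (?F # ls)" for i
  proof (cases i)
    case 0
    then show ?thesis by (auto simp: next_layer_def frontier_def ls list_ex_iff)
  next
    case (Suc i')
    then show ?thesis using assms(1) that by (auto simp: layering_stage_def)
  qed
  ultimately show ?thesis by (simp add: layering_stage_def)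
qed

lemma layers_stage:
  "layering_stage M (layers M)" "\<exists>xs. layers M = xs @ [[]]" "set (concat (layers M)) = {..<length M}"
proof -
  let ?n = "length M"
  let ?ls = "\<lambda>k. fold (\<lambda>_ ls. next_layer M ls # ls) [0..<k] [[]]"
  \<comment> \<open>Each round visits a new vertex as long as one is left, so \<open>n\<close>
    rounds reach them all; rounds after that add empty layers.\<close>
  have *: "layering_stage M (?ls k) \<and> (\<exists>xs. ?ls k = xs @ [[]]) \<and>
      min k ?n \<le> card (set (concat (?ls k)))" for k
  proof (induction k)
    case 0
    then show ?case by (auto simp: layering_stage_def layering_def)
  next
    case (Suc k)
    define ls where "ls = ?ls k"
    have IH: "layering_stage M ls" "\<exists>xs. ls = xs @ [[]]" "min k ?n \<le> card (set (concat ls))"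
      using Suc by (auto simp: ls_def)
    have eq: "?ls (Suc k) = next_layer M ls # ls" by (simp add: ls_def)
    have st: "layering_stage M (next_layer M ls # ls)"
      using layering_stage_Cons IH by blast
    have "min (Suc k) ?n \<le> card (set (concat (next_layer M ls # ls)))"
    proof (cases "next_layer M ls = []")
      case True
      then have "unvisited ?n ls = []"
        by (auto simp: next_layer_def split: if_splits)
      then have "{..<?n} \<subseteq> set (concat ls)"
        by (auto simp: unvisited_def filter_empty_conv)
      then have "?n \<le> card (set (concat ls))"
        using card_mono[of "set (concat ls)" "{..<?n}"] by simp
      then show ?thesis using True by simp
    next
      case False
      have d: "distinct (next_layer M ls @ concat ls)"
        using st by (simp add: layering_stage_def layering_def)
      have "card (set (next_layer M ls @ concat ls)) = length (next_layer M ls) + card (set (concat ls))"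
        using d distinct_card[of "next_layer M ls"] by (simp add: card_Un_disjoint)
      moreover have "length (next_layer M ls) \<ge> 1" using False by (cases "next_layer M ls") auto
      ultimately show ?thesis using IH(3) by simp
    qed
    then show ?case using st IH(2) unfolding eq by (metis append_Cons)
  qed
  show "layering_stage M (layers M)" "\<exists>xs. layers M = xs @ [[]]"
    using *[of ?n] by (auto simp: layers_def)
  have "set (concat (layers M)) \<subseteq> {..<?n}" "card {..<?n} \<le> card (set (concat (layers M)))"
    using *[of ?n] by (auto simp: layers_def layering_stage_def layering_def)
  then show "set (concat (layers M)) = {..<?n}"
    by (intro card_seteq) auto
qed


section \<open>Independent sets in the layers of a fuzzy circular interval graph\<close>

lemma exp_Arg2pi: "norm z = 1 \<Longrightarrow> exp (\<i> * of_real (Arg2pi z)) = z"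
  by (simp add: complex_norm_eq_1_exp)

text \<open>Change of origin: all angles are to be read from one point \<open>r\<close>, while
  membership in an arc is read from its first endpoint \<open>a\<close>. The second case occurs when
  the way from \<open>a\<close> to \<open>x\<close> passes \<open>r\<close>.\<close>

lemma Arg2pi_div_unit:
  assumes "norm a = 1" "norm x = 1" "norm r = 1"
  shows "Arg2pi (x / a) = (if Arg2pi (a / r) \<le> Arg2pi (x / r) then Arg2pi (x / r) - Arg2pi (a / r)
     else Arg2pi (x / r) - Arg2pi (a / r) + 2 * pi)"
proof -
  define A X where "A = Arg2pi (a / r)" and "X = Arg2pi (x / r)"
  have r: "r \<noteq> 0" "a \<noteq> 0" using assms by auto
  have b: "0 \<le> A" "A < 2 * pi" "0 \<le> X" "X < 2 * pi"
    by (simp_all add: A_def X_def Arg2pi Arg2pi_lt_2pi)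
  have "exp (\<i> * of_real A) = a / r" "exp (\<i> * of_real X) = x / r"
    unfolding A_def X_def using assms by (auto intro!: exp_Arg2pi simp: norm_divide)
  then have e: "exp (\<i> * of_real (X - A)) = x / a"
    using r by (simp add: right_diff_distrib exp_diff)
  have "exp (\<i> * of_real (X - A + 2 * pi)) = exp (\<i> * of_real (X - A))"
  proof -
    have "\<i> * of_real (X - A + 2 * pi) = \<i> * of_real (X - A) + 2 * of_real pi * \<i>"
      by (simp add: algebra_simps)
    then show ?thesis by (simp only: exp_add exp_two_pi_i mult_1_right)
  qed
  with e have e': "exp (\<i> * of_real (X - A + 2 * pi)) = x / a"
    by simp
  show ?thesis
  proof (cases "A \<le> X")
    case True
    with b e have "Arg2pi (x / a) = X - A"
      by (intro Arg2pi_unique[of 1]) auto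
    with True show ?thesis by (simp add: A_def X_def)
  next
    case False
    with b e' have "Arg2pi (x / a) = X - A + 2 * pi"
      by (intro Arg2pi_unique[of 1]) auto
    with False show ?thesis by (simp add: A_def X_def)
  qed
qed

lemma Arg2pi_div_inj:
  assumes "norm x = 1" "norm y = 1" "norm r = 1" "Arg2pi (x / r) = Arg2pi (y / r)"
  shows "x = y"
proof -
  have "norm (x / r) = 1" "norm (y / r) = 1"
    using assms by (simp_all add: norm_divide)
  then have "x / r = y / r"
    using exp_Arg2pi[of "x / r"] exp_Arg2pi[of "y / r"] assms(4) by metis
  moreover have "r \<noteq> 0" using assms by auto
  ultimately show ?thesis by simp
qed

lemma mem_circle_arc_iff:
  assumes "norm a = 1" "norm x = 1"
  shows "x \<in> circle_arc a b \<longleftrightarrow> Arg2pi (x / a) \<le> Arg2pi (b / a)"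
proof
  assume "x \<in> circle_arc a b"
  then obtain t where t: "x = a * cis t" "0 \<le> t" "t \<le> Arg2pi (b / a)"
    by (auto simp: circle_arc_def)
  have "Arg2pi (x / a) = t"
    using t assms Arg2pi_lt_2pi[of "b / a"]
    by (intro Arg2pi_unique[of 1]) (auto simp: cis_conv_exp)
  with t show "Arg2pi (x / a) \<le> Arg2pi (b / a)" by simp
next
  assume *: "Arg2pi (x / a) \<le> Arg2pi (b / a)"
  have "x = a * cis (Arg2pi (x / a))"
    using exp_Arg2pi[of "x / a"] assms by (auto simp: cis_conv_exp norm_divide)
  with * show "x \<in> circle_arc a b"
    unfolding circle_arc_def using Arg2pi_ge_0 by blast
qed

text \<open>Points of a circle of length \<open>p\<close>; \<open>D\<close> is the anticlockwise distance from \<open>A\<close>.\<close>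

lemma cyclic_interval_crossing:
  fixes A B U W Z1 Z2 p :: real
  assumes "0 \<le> A" "A < p" "0 \<le> B" "B < p" "0 \<le> U" "U < p" "0 \<le> W" "W < p"
    "0 \<le> Z1" "Z1 < p" "0 \<le> Z2" "Z2 < p"
    and D: "\<And>x. D x = (if A \<le> x then x - A else x - A + p)"
    and "D U \<le> D B" "D W \<le> D B" "Z1 < U" "U < Z2" "\<not> (Z1 < W \<and> W < Z2)" "W \<noteq> Z1" "W \<noteq> Z2"
  shows "D Z1 \<le> D B \<and> Z1 \<noteq> A \<and> Z1 \<noteq> B \<or> D Z2 \<le> D B \<and> Z2 \<noteq> A \<and> Z2 \<noteq> B"
proof -
  \<comment> \<open>Membership in the arc becomes a linear condition, split by whether the arc
    passes the origin.\<close>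
  have m: "D x \<le> D B \<longleftrightarrow> (if A \<le> B then A \<le> x \<and> x \<le> B else A \<le> x \<or> x \<le> B)"
    if "0 \<le> x" "x < p" for x
    using that assms(1-4) by (auto simp: D)
  have "W < Z1 \<or> Z2 < W"
    using assms by linarith
  \<comment> \<open>If the arc does not pass the origin, it contains the whole interval between
    \<open>U\<close> and \<open>W\<close>, hence in its interior the one of \<open>Z1\<close>,
    \<open>Z2\<close> that separates them. If it does, and neither were interior, both would lie
    between \<open>B\<close> and \<open>A\<close>, and \<open>U\<close> strictly between them would
    be outside the arc.\<close>
  then show ?thesis
    using assms(14-17) unfolding m[OF assms(5,6)] m[OF assms(7,8)] m[OF assms(9,10)] m[OF assms(11,12)]
    by (cases "A \<le> B") (simp_all, linarith+)
qed

text \<open>The chord from \<open>z1\<close> to \<open>z2\<close> separates \<open>u\<close> from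
  \<open>v\<close>. An arc containing both is connected, so it passes \<open>z1\<close> or
  \<open>z2\<close> on the way from one to the other and thus in its interior.\<close>

lemma circle_arc_crossing:
  assumes "norm a = 1" "norm b = 1" "norm u = 1" "norm v = 1" "norm z1 = 1" "norm z2 = 1" "norm r = 1"
    and "u \<in> circle_arc a b" "v \<in> circle_arc a b"
    and "Arg2pi (z1 / r) < Arg2pi (u / r)" "Arg2pi (u / r) < Arg2pi (z2 / r)"
    and "\<not> (Arg2pi (z1 / r) < Arg2pi (v / r) \<and> Arg2pi (v / r) < Arg2pi (z2 / r))"
    and "v \<noteq> z1" "v \<noteq> z2"
  shows "\<exists>z\<in>{z1, z2}. z \<in> circle_arc a b \<and> z \<noteq> a \<and> z \<noteq> b"
proof -
  define t where "t = (\<lambda>z. Arg2pi (z / r))"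
  have t: "0 \<le> t z" "t z < 2 * pi" for z
    by (simp_all add: t_def Arg2pi_ge_0 Arg2pi_lt_2pi)
  have neq: "t v \<noteq> t z1" "t v \<noteq> t z2"
    using assms Arg2pi_div_inj[of v _ r] by (auto simp: t_def)
  define D where "D x = (if t a \<le> x then x - t a else x - t a + 2 * pi)" for x
  have arc: "z \<in> circle_arc a b \<longleftrightarrow> D (t z) \<le> D (t b)" if "norm z = 1" for z
    using Arg2pi_div_unit[OF assms(1) that assms(7)] Arg2pi_div_unit[OF assms(1,2,7)]
    by (simp only: mem_circle_arc_iff[OF assms(1) that] t_def D_def)
  have "D (t z1) \<le> D (t b) \<and> t z1 \<noteq> t a \<and> t z1 \<noteq> t b \<or> D (t z2) \<le> D (t b) \<and> t z2 \<noteq> t a \<and> t z2 \<noteq> t b"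
    by (rule cyclic_interval_crossing[where U = "t u" and W = "t v", OF t(1) t(2) t(1) t(2) t(1) t(2) t(1) t(2) t(1) t(2) t(1) t(2) D_def])
      (use assms(8-12) neq arc[OF assms(3)] arc[OF assms(4)] in \<open>auto simp: t_def\<close>)
  then show ?thesis
    using arc[OF assms(5)] arc[OF assms(6)] by blast
qed

lemma five_in_order:
  fixes g :: "'a \<Rightarrow> real"
  assumes "finite S" "inj_on g S" "5 \<le> card S"
  obtains s1 s2 s3 s4 s5 where "s1 \<in> S" "s2 \<in> S" "s3 \<in> S" "s4 \<in> S" "s5 \<in> S"
    "g s1 < g s2" "g s2 < g s3" "g s3 < g s4" "g s4 < g s5"
proof -
  define l where "l = sorted_list_of_set (g ` S)"
  have len: "5 \<le> length l"
    using assms by (simp add: l_def card_image)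
  have "set l = g ` S"
    using assms by (simp add: l_def)
  then have "\<exists>s\<in>S. g s = l ! i" if "i < 5" for i
    using len that nth_mem[of i l] by (metis (no_types) image_iff less_le_trans)
  then obtain s where s: "\<And>i. i < 5 \<Longrightarrow> s i \<in> S \<and> g (s i) = l ! i"
    by metis
  have lt: "g (s i) < g (s (Suc i))" if "Suc i < 5" for i
    using s[of i] s[of "Suc i"] that len
    sorted_wrt_nth_less[OF strict_sorted_list_of_set[of "g ` S", folded l_def], of i "Suc i"] by simp
  show thesis
    by (rule that[of "s 0" "s 1" "s 2" "s 3" "s 4"])
      (use s lt[of 0] lt[of 1] lt[of 2] lt[of 3] in \<open>auto simp: eval_nat_numeral\<close>)
qed

text \<open>Stated for an abstract level function, counted upwards from the oldest layer:
  \<open>lev\<close> bounds the jump along an edge, and \<open>parent\<close> says that a vertex is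
  alone in its level or has a neighbour one level below.\<close>

lemma fuzzy_circular_level_independence:
  fixes f :: "'a \<Rightarrow> complex" and lev :: "'a \<Rightarrow> nat"
  assumes unit: "\<And>x. x \<in> V \<Longrightarrow> norm (f x) = 1"
    and ends: "\<And>a b. (a, b) \<in> \<I> \<Longrightarrow> norm a = 1 \<and> norm b = 1 \<and> a \<noteq> b"
    and edge: "\<And>x y. x \<in> V \<Longrightarrow> y \<in> V \<Longrightarrow> adj x y \<Longrightarrow>
      \<exists>(a, b)\<in>\<I>. f x \<in> circle_arc a b \<and> f y \<in> circle_arc a b"
    and nonedge: "\<And>x y a b. x \<in> V \<Longrightarrow> y \<in> V \<Longrightarrow> x \<noteq> y \<Longrightarrow> \<not> adj x y \<Longrightarrow> (a, b) \<in> \<I> \<Longrightarrow>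
      f x \<in> circle_arc a b \<Longrightarrow> f y \<in> circle_arc a b \<Longrightarrow> {a, b} = {f x, f y}"
    and sym: "\<And>x y. x \<in> V \<Longrightarrow> y \<in> V \<Longrightarrow> adj x y \<Longrightarrow> adj y x"
    and lev: "\<And>x y. x \<in> V \<Longrightarrow> y \<in> V \<Longrightarrow> adj x y \<Longrightarrow> lev x \<le> Suc (lev y)"
    and parent: "\<And>x. x \<in> V \<Longrightarrow> (\<forall>y\<in>V. lev y = lev x \<longrightarrow> y = x) \<or> (\<exists>p\<in>V. adj p x \<and> lev x = Suc (lev p))"
    and S: "finite S" "S \<subseteq> V" "\<And>x. x \<in> S \<Longrightarrow> lev x = d"
      "\<And>x y. x \<in> S \<Longrightarrow> y \<in> S \<Longrightarrow> x \<noteq> y \<Longrightarrow> \<not> adj x y"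
  shows "card S \<le> 4"
proof (rule ccontr)
  assume "\<not> card S \<le> 4"
  then have card: "5 \<le> card S" by simp
  define single where "single k \<longleftrightarrow> (\<exists>r\<in>V. lev r = k \<and> (\<forall>y\<in>V. lev y = k \<longrightarrow> y = r))" for k
  have "\<exists>k\<le>n. single k" if "x \<in> V" "lev x = n" for x n
    using that
  proof (induction n arbitrary: x)
    case 0
    then show ?case using parent[of x] by (auto simp: single_def)
  next
    case (Suc n)
    show ?case
    proof (cases "single (Suc n)")
      case False
      then obtain p where "p \<in> V" "lev p = n"
        using parent[of x] Suc.prems by (auto simp: single_def)
      then show ?thesis using Suc.IH le_Suc_eq by blast
    qed auto
  qed
  moreover obtain s0 where "s0 \<in> S" using card by fastforce
  ultimately have ex: "\<exists>k\<le>d. single k" using S by blast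
  \<comment> \<open>Between the last one-vertex level and level \<open>d\<close>, every vertex has a
    parent, so descending paths from \<open>S\<close> end in that single vertex. It serves as root
    even if the search did not start there.\<close>
  define j where "j = Max {k. k \<le> d \<and> single k}"
  have fin: "finite {k. k \<le> d \<and> single k}" by simp
  have j: "j \<le> d" "single j"
    using Max_in[OF fin] ex by (auto simp: j_def)
  have jmax: "\<not> single k" if "j < k" "k \<le> d" for k
  proof
    assume "single k"
    then have "k \<le> j"
      unfolding j_def using that fin by (intro Max_ge) auto
    with that show False by simp
  qed
  have par: "\<exists>p\<in>V. adj p x \<and> lev x = Suc (lev p)" if "x \<in> V" "j < lev x" "lev x \<le> d" for x
    using parent[OF that(1)] jmax[OF that(2,3)] that(1) by (auto simp: single_def)
  have "j < d"
  proof (rule ccontr)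
    assume "\<not> j < d"
    then have "single d" using j by simp
    then obtain r where "S \<subseteq> {r}"
      unfolding single_def using S by blast
    then have "card S \<le> 1" using card_mono[of "{r}" S] by simp
    with card show False by simp
  qed
  obtain r where r: "r \<in> V" "lev r = j" "\<And>y. y \<in> V \<Longrightarrow> lev y = j \<Longrightarrow> y = r"
    using j(2) by (auto simp: single_def)
  \<comment> \<open>An arc covering the edge from \<open>p\<close> to \<open>x\<close> also contains
    \<open>f y\<close>. If \<open>x\<close> and \<open>y\<close> were not adjacent, both its
    endpoints would be this one point, but they differ.\<close>
  have same_point: "adj x y"
    if "x \<in> V" "y \<in> V" "x \<noteq> y" "f x = f y" "p \<in> V" "adj p x" for x y p
  proof (rule ccontr)
    assume "\<not> adj x y"
    obtain a b where "(a, b) \<in> \<I>" "f x \<in> circle_arc a b"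
      using edge[OF \<open>p \<in> V\<close> \<open>x \<in> V\<close> \<open>adj p x\<close>] by blast
    then show False
      using nonedge[OF that(1-3) \<open>\<not> adj x y\<close>, of a b] that(4) ends[of a b] by auto
  qed
  have parS: "\<exists>p\<in>V. adj p x \<and> Suc (lev p) = d" if "x \<in> S" for x
    using par[of x] S(2) S(3)[OF that] that \<open>j < d\<close> by fastforce
  have inj: "inj_on f S"
    using same_point S parS by (meson inj_onI subsetD)
  define \<theta> where "\<theta> z = Arg2pi (z / f r)" for z
  have inj_angle: "inj_on (\<lambda>x. \<theta> (f x)) S"
    using inj S(2) unit r(1) Arg2pi_div_inj unfolding \<theta>_def inj_on_def by (metis subsetD)
  obtain s1 s2 s3 s4 s5 where s: "s1 \<in> S" "s2 \<in> S" "s3 \<in> S" "s4 \<in> S" "s5 \<in> S"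
    and lt: "\<theta> (f s1) < \<theta> (f s2)" "\<theta> (f s2) < \<theta> (f s3)" "\<theta> (f s3) < \<theta> (f s4)" "\<theta> (f s4) < \<theta> (f s5)"
    by (rule five_in_order[OF S(1) inj_angle card]) (rule that)
  obtain p where p: "p \<in> V" "adj p s3" "Suc (lev p) = d"
    using parS[OF s(3)] by blast
  \<comment> \<open>Of \<open>s1\<close> and \<open>s2\<close>, at most one is at the point of
    \<open>p\<close>, as their angles differ.\<close>
  obtain z1 where z1: "z1 \<in> S" "\<theta> (f z1) < \<theta> (f s3)" "f z1 \<noteq> f p"
    using s lt by (metis less_irrefl less_trans)
  obtain z2 where z2: "z2 \<in> S" "\<theta> (f s3) < \<theta> (f z2)" "f z2 \<noteq> f p"
    using s lt by (metis less_irrefl less_trans)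
  \<comment> \<open>\<open>s3\<close> and the root are on different sides of the chord from \<open>z1\<close> to \<open>z2\<close>; no edge of a tree
    path from the root to \<open>s3\<close> through \<open>p\<close> can change sides.\<close>
  define side where "side x \<longleftrightarrow> \<theta> (f z1) < \<theta> (f x) \<and> \<theta> (f x) < \<theta> (f z2)" for x
  have cross: "\<exists>z\<in>{z1, z2}. (adj z u \<or> z = u) \<and> (adj z v \<or> z = v)"
    if "u \<in> V" "v \<in> V" "adj u v" "side u" "\<not> side v" "f v \<noteq> f z1" "f v \<noteq> f z2" for u v
  proof -
    obtain a b where ab: "(a, b) \<in> \<I>" "f u \<in> circle_arc a b" "f v \<in> circle_arc a b"
      using edge[OF \<open>u \<in> V\<close> \<open>v \<in> V\<close> \<open>adj u v\<close>] by blast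
    have "\<exists>z\<in>{f z1, f z2}. z \<in> circle_arc a b \<and> z \<noteq> a \<and> z \<noteq> b"
      by (rule circle_arc_crossing[where u = "f u" and v = "f v" and r = "f r"])
        (use ab ends[OF ab(1)] that z1 z2 S(2) unit r(1) in \<open>auto simp: side_def \<theta>_def\<close>)
    then obtain z where z: "z \<in> {z1, z2}" "f z \<in> circle_arc a b" "f z \<noteq> a" "f z \<noteq> b"
      by blast
    \<comment> \<open>A non-neighbour in the same arc would force \<open>f z\<close> to be an
      endpoint.\<close>
    have "adj z x \<or> z = x" if "x \<in> V" "f x \<in> circle_arc a b" for x
    proof (rule ccontr)
      assume *: "\<not> (adj z x \<or> z = x)"
      have "z \<in> V" using z z1 z2 S(2) by auto
      with nonedge[OF this that(1) _ _ ab(1) z(2) that(2)] * have "{a, b} = {f z, f x}"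
        by blast
      with z show False by (auto simp: doubleton_eq_iff)
    qed
    with z(1) ab that show ?thesis by blast
  qed
  have near: "Suc (lev w) \<ge> d" if "w \<in> V" "z \<in> {z1, z2}" "adj z w \<or> z = w" for w z
    using lev[of z w] that z1(1) z2(1) S by auto
  \<comment> \<open>For \<open>p\<close> this is the choice of \<open>z1\<close> and
    \<open>z2\<close>. A lower vertex at one of these points would be adjacent to an element of
    \<open>S\<close>, too far above it.\<close>
  have avoid: "f w \<noteq> f z1 \<and> f w \<noteq> f z2" if "w \<in> V" "Suc (lev w) < d \<or> w = p" for w
  proof -
    have "adj z w \<or> z = w" if "z \<in> {z1, z2}" "f w = f z" for z
      using same_point[of z w] parS[of z] \<open>w \<in> V\<close> z1 z2 S(2) that by auto
    then show ?thesis
      using near[OF that(1)] that(2) z1 z2 by fastforce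
  qed
  \<comment> \<open>The lower end \<open>v\<close> is at least two levels below \<open>S\<close>, so
    it cannot be adjacent to \<open>z1\<close> or \<open>z2\<close>, as a change of sides would
    require.\<close>
  have far: "side u = side v"
    if "u \<in> V" "v \<in> V" "adj u v" "Suc (lev v) = lev u" "Suc (lev u) < d \<or> u = p" for u v
  proof (rule ccontr)
    assume ne: "side u \<noteq> side v"
    have "Suc (lev v) < d" using that p by auto
    then have av: "f u \<noteq> f z1" "f u \<noteq> f z2" "f v \<noteq> f z1" "f v \<noteq> f z2"
      using avoid[of u] avoid[of v] that by auto
    have "\<exists>z\<in>{z1, z2}. (adj z u \<or> z = u) \<and> (adj z v \<or> z = v)"
      using cross[of u v] cross[of v u] ne av that sym[of u v] by blast
    then show False using near[of v] that \<open>Suc (lev v) < d\<close> by fastforce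
  qed
  \<comment> \<open>The root has angle 0, and no angle is smaller.\<close>
  have "\<not> side r"
    using Arg2pi_ge_0[of "f z1 / f r"] unit[OF r(1)] Arg2pi_of_real[of 1] by (auto simp: side_def \<theta>_def)
  have inner: "\<not> side w" if "w \<in> V" "lev w = k" "j \<le> k" "Suc k < d \<or> w = p" for w k
    using that(3,1,2,4)
  proof (induction k arbitrary: w rule: dec_induct)
    case base
    then show ?case using r \<open>\<not> side r\<close> by blast
  next
    case (step k)
    have "lev w \<le> d" using step.prems p by auto
    then obtain q where q: "q \<in> V" "adj q w" "lev w = Suc (lev q)"
      using par[of w] step by auto
    moreover have "Suc (lev q) < d" using q step.prems p by auto
    ultimately have "\<not> side q" using step by auto
    then show ?case
      using far[of w q] q step.prems sym[of q w] by auto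
  qed
  have "\<not> side p" using inner[OF p(1) refl] p \<open>j < d\<close> by simp
  moreover have "side s3" using z1 z2 by (simp add: side_def)
  \<comment> \<open>The last edge has its lower end \<open>p\<close> only one level below, so levels
    do not exclude a crossing here; instead its upper end \<open>s3\<close> would be adjacent to
    another element of \<open>S\<close>.\<close>
  ultimately obtain z where z: "z \<in> {z1, z2}" "adj z s3 \<or> z = s3"
    using cross[of s3 p] p s S(2) sym[OF p(1) _ p(2)] avoid[OF p(1)] by blast
  then show False
    using S(4)[of z s3] z1 z2 s(3) by auto
qed


section \<open>Adjacency matrices\<close>

definition adjacency_matrix :: "nat \<Rightarrow> nat pair_pre_digraph \<Rightarrow> bool list list" where
  "adjacency_matrix n D = map (\<lambda>u. map (\<lambda>v. u \<rightarrow>\<^bsub>D\<^esub> v) [0..<n]) [0..<n]"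

lemma length_adjacency_matrix [simp]: "length (adjacency_matrix n D) = n"
  by (simp add: adjacency_matrix_def)

lemma hd_or_drop: "i < length xs \<Longrightarrow> hd_or d (drop i xs) = xs ! i"
  by (simp add: Cons_nth_drop_Suc[symmetric])

lemma entry_adjacency_matrix [simp]:
  "u < n \<Longrightarrow> v < n \<Longrightarrow> entry (adjacency_matrix n D) u v \<longleftrightarrow> u \<rightarrow>\<^bsub>D\<^esub> v"
  by (simp add: entry_def adjacency_matrix_def hd_or_drop)

lemma encode_bits: "encode bs = enc_bits bs"
  by (simp add: encode_list_def enc_bits_def encode_bool_def[abs_def])

lemma encode_adjacency_matrix: "encode (adjacency_matrix n D) = enc_digraph n D"
  by (simp add: encode_list_def[where 'a = "bool list"] encode_bits adjacency_matrix_def enc_digraph_def o_def)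

lemma esize_adjacency_matrix: "esize (adjacency_matrix n D) \<le> n * (2 * n + 1)"
proof -
  have "esize (adjacency_matrix n D) \<le> length (adjacency_matrix n D) * Suc (2 * n)"
  proof (rule esize_le_length)
    fix r
    assume "r \<in> set (adjacency_matrix n D)"
    then show "esize r \<le> 2 * n"
      using esize_bools_le[of r] by (auto simp: adjacency_matrix_def)
  qed
  then show ?thesis by simp
qed

lemma kernel_sets_adjacency_matrix:
  assumes "pverts D = {..<n}"
  shows "kernel_sets (adjacency_matrix n D) = {K. is_kernel D K}"
proof -
  have "K \<in> kernel_sets (adjacency_matrix n D) \<longleftrightarrow> is_kernel D K" for K
  proof (cases "K \<subseteq> {..<n}")
    case True
    have e: "(\<exists>w\<in>K. entry (adjacency_matrix n D) v w) \<longleftrightarrow> (\<exists>w\<in>K. v \<rightarrow>\<^bsub>D\<^esub> w)" if "v < n" for v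
      using True that by (intro bex_cong) auto
    have "K \<in> kernel_sets (adjacency_matrix n D) \<longleftrightarrow>
        (\<forall>v<n. (v \<in> K) \<noteq> (\<exists>w\<in>K. entry (adjacency_matrix n D) v w))"
      using True by (simp add: kernel_sets_def)
    also have "\<dots> \<longleftrightarrow> (\<forall>v<n. (v \<in> K) \<noteq> (\<exists>w\<in>K. v \<rightarrow>\<^bsub>D\<^esub> w))"
      using e by blast
    also have "\<dots> \<longleftrightarrow> is_kernel D K"
      using True unfolding is_kernel_def assms by blast
    finally show ?thesis .
  next
    case False
    then show ?thesis by (auto simp: kernel_sets_def is_kernel_def assms)
  qed
  then show ?thesis by blast
qed

lemma distinct_concat_nth_disjoint:
  assumes "distinct (concat ls)" "i < j" "j < length ls"
  shows "set (ls ! i) \<inter> set (ls ! j) = {}"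
proof -
  have "ls = take j ls @ ls ! j # drop (Suc j) ls"
    using assms(3) by (rule id_take_nth_drop)
  then have "distinct (concat (take j ls) @ ls ! j @ concat (drop (Suc j) ls))"
    using assms(1) by (metis concat.simps(2) concat_append)
  moreover have "ls ! i \<in> set (take j ls)"
    using assms by (metis in_set_conv_nth length_take min.absorb4 nth_take)
  ultimately show ?thesis by auto
qed

lemma arcs_mk_symmetric:
  fixes D :: "'a pair_pre_digraph"
  shows "x \<rightarrow>\<^bsub>mk_symmetric D\<^esub> y \<longleftrightarrow> x \<rightarrow>\<^bsub>D\<^esub> y \<or> y \<rightarrow>\<^bsub>D\<^esub> x"
proof -
  have "parcs (mk_symmetric D) = parcs D \<union> (parcs D)\<inverse>"
    by (auto simp: parcs_mk_symmetric)
  then show ?thesis by simp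
qed

lemma small_independence_layers:
  fixes D :: "nat pair_pre_digraph"
  assumes V: "pverts D = {..<n}" and fuzzy: "fuzzy_circular_interval_graph (mk_symmetric D)"
    and L: "L \<in> set (layers (adjacency_matrix n D))"
  shows "small_independence (adjacency_matrix n D) L"
  unfolding small_independence_def
proof (intro allI impI)
  let ?M = "adjacency_matrix n D"
  let ?ls = "layers ?M"
  fix X
  assume X: "X \<subseteq> set L" "\<forall>u\<in>X. \<forall>w\<in>X. \<not> entry ?M u w"
  have stage: "layering_stage ?M ?ls" and all: "set (concat ?ls) = {..<n}"
    using layers_stage[of ?M] by auto
  then have lay: "layering ?M ?ls" by (simp add: layering_stage_def)
  define idx where "idx x = (THE i. i < length ?ls \<and> x \<in> set (?ls ! i))" for x
  have idxI: "idx x = i" if "i < length ?ls" "x \<in> set (?ls ! i)" for x i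
    unfolding idx_def
  proof (rule the_equality)
    fix i'
    assume *: "i' < length ?ls \<and> x \<in> set (?ls ! i')"
    have "distinct (concat ?ls)" using lay by (simp add: layering_def)
    from distinct_concat_nth_disjoint[OF this, of i i'] distinct_concat_nth_disjoint[OF this, of i' i]
    show "i' = i" using that * by (cases i i' rule: linorder_cases) auto
  qed (use that in auto)
  have idx: "idx x < length ?ls" "x \<in> set (?ls ! idx x)" if x: "x < n" for x
  proof -
    have "x \<in> set (concat ?ls)" using x all by simp
    then obtain i where "i < length ?ls" "x \<in> set (?ls ! i)"
      unfolding set_concat by (metis UN_E in_set_conv_nth)
    then show "idx x < length ?ls" "x \<in> set (?ls ! idx x)" using idxI[of i x] by auto
  qed
  \<comment> \<open>Positions count from the newest layer, levels from the oldest; subtraction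
    reverses the order, and \<open>idx x < length ?ls\<close> keeps it injective on
    positions.\<close>
  define lev where "lev x = length ?ls - idx x" for x
  have close: "lev x \<le> Suc (lev y)" if "x < n" "y < n" "linked ?M x y" for x y
  proof (cases "idx x < idx y")
    case True
    then have "idx y = Suc (idx x)"
      using lay idx[OF that(1)] idx[OF that(2)] that(3) unfolding layering_def by blast
    then show ?thesis by (simp add: lev_def)
  qed (simp add: lev_def)
  have parent: "(\<forall>y\<in>{..<n}. lev y = lev x \<longrightarrow> y = x) \<or> (\<exists>p\<in>{..<n}. linked ?M p x \<and> lev x = Suc (lev p))"
    if x: "x < n" for x
  proof -
    consider "length (?ls ! idx x) \<le> 1"
      | "Suc (idx x) < length ?ls" "\<forall>v\<in>set (?ls ! idx x). \<exists>u\<in>set (?ls ! Suc (idx x)). linked ?M u v"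
      using stage idx(1)[OF x] by (auto simp: layering_stage_def)
    then show ?thesis
    proof cases
      case 1
      have "y = x" if "y < n" "lev y = lev x" for y
      proof -
        have "idx y = idx x" using that idx(1)[of y] idx(1)[OF x] by (auto simp: lev_def)
        then have "{x, y} \<subseteq> set (?ls ! idx x)" using idx(2)[OF x] idx(2)[of y] that by auto
        with 1 show ?thesis by (cases "?ls ! idx x") auto
      qed
      then show ?thesis by blast
    next
      case 2
      then obtain u where u: "u \<in> set (?ls ! Suc (idx x))" "linked ?M u x"
        using idx(2)[OF x] by blast
      have "u \<in> set (concat ?ls)" using u(1) 2(1) by auto
      then have "u < n" unfolding all by simp
      moreover have "lev x = Suc (lev u)" using idxI[OF 2(1) u(1)] 2(1) by (simp add: lev_def)
      ultimately show ?thesis using u by blast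
    qed
  qed
  obtain f :: "nat \<Rightarrow> complex" and \<I> where
    f: "f ` pverts (mk_symmetric D) \<subseteq> sphere 0 1"
    and ends: "\<forall>(a, b)\<in>\<I>. a \<in> sphere 0 1 \<and> b \<in> sphere 0 1 \<and> a \<noteq> b"
    and edge: "\<forall>x\<in>pverts (mk_symmetric D). \<forall>y\<in>pverts (mk_symmetric D). x \<rightarrow>\<^bsub>mk_symmetric D\<^esub> y \<longrightarrow>
           (\<exists>(a, b)\<in>\<I>. f x \<in> circle_arc a b \<and> f y \<in> circle_arc a b)"
    and nonedge: "\<forall>x\<in>pverts (mk_symmetric D). \<forall>y\<in>pverts (mk_symmetric D). x \<noteq> y \<and> \<not> x \<rightarrow>\<^bsub>mk_symmetric D\<^esub> y \<longrightarrow>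
           (\<forall>(a, b)\<in>\<I>. f x \<in> circle_arc a b \<and> f y \<in> circle_arc a b \<longrightarrow> {a, b} = {f x, f y})"
    using fuzzy unfolding fuzzy_circular_interval_graph_def by (elim exE conjE) (rule that)
  have V': "pverts (mk_symmetric D) = {..<n}" by (simp add: V)
  have adj: "x \<rightarrow>\<^bsub>mk_symmetric D\<^esub> y \<longleftrightarrow> linked ?M x y" if "x < n" "y < n" for x y
    unfolding arcs_mk_symmetric using that by (simp add: linked_def)
  obtain i where i: "i < length ?ls" "L = ?ls ! i" using L by (auto simp: in_set_conv_nth)
  have XV: "X \<subseteq> {..<n}" using X(1) L all by auto
  show "card X \<le> 4"
  proof (rule fuzzy_circular_level_independence[where V = "{..<n}" and adj = "linked ?M" and lev = lev
        and d = "length ?ls - i" and f = f and \<I> = \<I>])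
    show "\<exists>(a, b)\<in>\<I>. f x \<in> circle_arc a b \<and> f y \<in> circle_arc a b"
      if "x \<in> {..<n}" "y \<in> {..<n}" "linked ?M x y" for x y
      using edge that adj[of x y] unfolding V' by auto
    show "{a, b} = {f x, f y}" if "x \<in> {..<n}" "y \<in> {..<n}" "x \<noteq> y" "\<not> linked ?M x y" "(a, b) \<in> \<I>"
      "f x \<in> circle_arc a b" "f y \<in> circle_arc a b" for x y a b
      using nonedge that adj[of x y] unfolding V' by fastforce
    show "finite X" using XV finite_subset by blast
    show "lev x = length ?ls - i" if "x \<in> X" for x
      using idxI[of i x] i X(1) that by (auto simp: lev_def)
    show "\<not> linked ?M x y" if "x \<in> X" "y \<in> X" "x \<noteq> y" for x y
      using X(2) that by (auto simp: linked_def)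
  qed (use f ends V' XV close parent linked_sym in auto)
qed

theorem theorem14:
  shows "\<exists>(algorithm :: com) (p :: nat poly). \<forall>(n :: nat) (D :: nat pair_pre_digraph).
    pair_digraph D \<and> pverts D = {..<n} \<and> fuzzy_circular_interval_graph (mk_symmetric D) \<longrightarrow>
    (\<exists>t bs k. computes_in algorithm (enc_digraph n D) t (Nd (enc_bits bs) k) \<and>
       t \<le> poly p n \<and>
       binary_of bs (card {K. is_kernel D K}) \<and>
       ((\<exists>K. is_kernel D K) \<longrightarrow> (\<exists>K. is_kernel D K \<and> k = enc_set n K)))"
proof -
  obtain c N p where c: "runs c N p count_and_find"
    using ptime_count_and_find by (auto simp: ptime_def)
  show ?thesis
  \<comment> \<open>The inner polynomial is \<open>n + 2 * n ^ 2\<close>, the bound on the size of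
    the encoded matrix.\<close>
  proof (intro exI[of _ c] exI[of _ "p \<circ>\<^sub>p [:0, 1, 2:]"] allI impI)
    fix n and D :: "nat pair_pre_digraph"
    assume "pair_digraph D \<and> pverts D = {..<n} \<and> fuzzy_circular_interval_graph (mk_symmetric D)"
    then have D: "pverts D = {..<n}" "fuzzy_circular_interval_graph (mk_symmetric D)"
      by auto
    let ?M = "adjacency_matrix n D"
    obtain t s where run: "exec c ((\<lambda>_. Lf)(0 := encode ?M)) t s" "s 0 = encode (count_and_find ?M)"
      "t \<le> poly p (esize ?M)"
      using runsE[OF c, where s = "(\<lambda>_. Lf)(0 := encode ?M)" and x = ?M] by (metis fun_upd_same)
    have "computes_in c (enc_digraph n D) t (Nd (enc_bits (fst (count_and_find ?M))) (encode (snd (count_and_find ?M))))"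
      using run(1,2) unfolding computes_in_def encode_adjacency_matrix
      by (auto simp: encode_prod_def encode_bits)
    moreover have "t \<le> poly (p \<circ>\<^sub>p [:0, 1, 2:]) n"
    proof -
      have "poly p (esize ?M) \<le> poly p (n * (2 * n + 1))"
        by (intro poly_nat_mono esize_adjacency_matrix)
      also have "\<dots> = poly (p \<circ>\<^sub>p [:0, 1, 2:]) n"
        by (auto simp: poly_pcompose algebra_simps mult_2 intro!: arg_cong[of _ _ "poly p"])
      finally show ?thesis using run(3) by simp
    qed
    moreover obtain xs where "layers ?M = xs @ [[]]" "layering ?M (layers ?M)"
        "set (concat (layers ?M)) = {..<length ?M}"
      using layers_stage[of ?M] by (auto simp: layering_stage_def)
    note correct = count_and_find_correct[OF this(2) small_independence_layers[OF D] this(1,3),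
        unfolded kernel_sets_adjacency_matrix[OF D(1)]]
    moreover have "\<exists>K. is_kernel D K \<and> encode (snd (count_and_find ?M)) = enc_set n K"
      if "\<exists>K. is_kernel D K"
      using correct(2) that by (auto simp: encode_bits enc_set_def)
    ultimately show "\<exists>t bs k. computes_in c (enc_digraph n D) t (Nd (enc_bits bs) k) \<and>
       t \<le> poly (p \<circ>\<^sub>p [:0, 1, 2:]) n \<and>
       binary_of bs (card {K. is_kernel D K}) \<and>
       ((\<exists>K. is_kernel D K) \<longrightarrow> (\<exists>K. is_kernel D K \<and> k = enc_set n K))"
      unfolding binary_of_def by blast
  qed
qed

end
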